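(* Let $\Delta_\nu(x,u^{(n)})=0$, $1\le\nu\le l$, be a nondegenerate system of partial differential equations with $\Delta=(\Delta_1,\dots,\Delta_l)$ smooth. Let $G=\{g_\eta:\eta\in(-\eta_o,\eta_o)\}$ be a one-parameter symmetry group of this system and write $g_\eta\cdot(x,u)=(\Xi_\eta(x,u),\Phi_\eta(x,u))$. Then there exist $C^\infty$-functions $Q_{\mu\nu}:(-\eta_o,\eta_o)\times\mathcal V\to\mathbb R$ ($1\le\mu,\nu\le l$, $\mathcal V$ an open subset of $\mathcal M^{(n)}$) such that, whenever $u:\Omega\subseteq\mathbb R^p\to\mathbb R^q$ is smooth and $g_\eta u$ exists, one has for $1\le\nu\le l$ $$\Delta_\nu\big(\Xi_\eta(x,u(x)),\mathrm{pr}^{(n)}(g_\eta u)(\Xi_\eta(x,u(x)))\big)=\sum_{\mu=1}^l Q_{\mu\nu}(\eta,x,\mathrm{pr}^{(n)}u(x))\,\Delta_\mu(x,\mathrm{pr}^{(n)}u(x))$$ on the domain of $g_\eta u$ (that is, for the points $x\in\Omega$ such that $\Xi_\eta(x,u(x))$ lies in the domain of $g_\eta u$).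
   Context: The independent variables are $x\in\mathcal X=\mathbb R^p$, the dependent variables $u\in\mathcal U=\mathbb R^q$. The group acts as a smooth local transformation group on an open set $\mathcal M\subseteq\mathcal X\times\mathcal U$; $\mathcal M^{(n)}$ is the $n$-jet space of $\mathcal M$, with coordinates $(x,u^{(n)})$, where $u^{(n)}$ collects $u$ and all its formal partial derivatives up to order $n$. For a smooth function $u$, $\mathrm{pr}^{(n)}u(x)$ is the collection of the values at $x$ of $u$ and all its partial derivatives up to order $n$. The function $g_\eta u$ (if it exists) is the function whose graph is the image of the graph of $u$ under $g_\eta$. The system is nondegenerate if $\Delta$ has maximal rank $l$ at every point of $S_\Delta=\{(x,u^{(n)}):\Delta(x,u^{(n)})=0\}$ and the system is locally solvable at every point of $S_\Delta$ (i.e. for every $(x_0,u_0^{(n)})\in S_\Delta$ there is a smooth solution $u$ near $x_0$ with $\mathrm{pr}^{(n)}u(x_0)=u_0^{(n)}$). A symmetry group of the system is a local transformation group such that whenever $u$ is a smooth solution and $g_\eta u$ is defined, $g_\eta u$ is a solution.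
   Formalization: The open set V may depend on η: the Q's are smooth on the open set of (η,z) with z in V_η, which contains all (η,x,pr u(x)) where g_η u exists. A fixed V fails: for rotations and u_xx=0, Q=(cos η − u_x sin η)^(-3) blows up. *)

theory Defs
  imports "HOL-Analysis.Analysis" "HOL-Library.Multiset"
begin

section \<open>Smooth maps\<close>

fun Ck_on :: "nat \<Rightarrow> 'a::real_normed_vector set \<Rightarrow> ('a \<Rightarrow> 'b::real_normed_vector) \<Rightarrow> bool" where
  "Ck_on 0 S f \<longleftrightarrow> continuous_on S f"
| "Ck_on (Suc k) S f \<longleftrightarrow>
     (\<forall>x\<in>S. f differentiable (at x)) \<and>
     (\<forall>v. Ck_on k S (\<lambda>x. frechet_derivative f (at x) v))"

text \<open>Used only for open subsets of Euclidean spaces.\<close>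

definition smooth_on :: "'a::real_normed_vector set \<Rightarrow> ('a \<Rightarrow> 'b::real_normed_vector) \<Rightarrow> bool" where
  "smooth_on S f \<longleftrightarrow> (\<forall>k. Ck_on k S f)"


section \<open>Jets\<close>

text \<open>
  The order \<open>n\<close> is \<open>CARD('n)\<close>. The formal derivatives of order at most \<open>n\<close> in the \<open>p = CARD('p)\<close>
  independent variables are indexed by the unordered tuples \<open>J\<close> of at most \<open>n\<close> indices, so that
  mixed derivatives which differ only in the order of differentiation are one coordinate.
\<close>

typedef ('p, 'n) jet_index = "{J :: 'p multiset. size J \<le> CARD('n)}"
  by (rule exI[of _ "{#}"]) simp

instance jet_index :: (finite, type) finite
proof
  have "finite {xs :: 'a list. set xs \<subseteq> UNIV \<and> length xs \<le> CARD('b)}"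
    by (rule finite_lists_length_le) simp
  then have "finite (mset ` {xs :: 'a list. set xs \<subseteq> UNIV \<and> length xs \<le> CARD('b)})"
    by (rule finite_imageI)
  moreover have "{J :: 'a multiset. size J \<le> CARD('b)}
      \<subseteq> mset ` {xs :: 'a list. set xs \<subseteq> UNIV \<and> length xs \<le> CARD('b)}"
  proof
    fix J :: "'a multiset" assume J: "J \<in> {J. size J \<le> CARD('b)}"
    obtain xs where "mset xs = J" using ex_mset by blast
    with J show "J \<in> mset ` {xs :: 'a list. set xs \<subseteq> UNIV \<and> length xs \<le> CARD('b)}"
      by (auto intro!: image_eqI[of _ _ xs])
  qed
  ultimately have "finite {J :: 'a multiset. size J \<le> CARD('b)}"
    by (rule finite_subset[rotated])
  then have "finite (Abs_jet_index ` {J :: 'a multiset. size J \<le> CARD('b)} :: ('a, 'b) jet_index set)"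
    by (rule finite_imageI)
  moreover have "(UNIV :: ('a, 'b) jet_index set) = Abs_jet_index ` {J. size J \<le> CARD('b)}"
    by (rule type_definition.Abs_image[OF type_definition_jet_index, symmetric])
  ultimately show "finite (UNIV :: ('a, 'b) jet_index set)" by simp
qed

type_synonym ('p, 'q, 'n) jet_fibre = "(real ^ 'q) ^ ('p, 'n) jet_index"
type_synonym ('p, 'q, 'n) jet = "(real ^ 'p) \<times> ('p, 'q, 'n) jet_fibre"

definition jet_space ::
    "((real ^ 'p::finite) \<times> (real ^ 'q::finite)) set \<Rightarrow> ('p, 'q, 'n) jet set" where
  "jet_space M = {(x, w). (x, w $ Abs_jet_index {#}) \<in> M}"

fun iter_partial :: "'p::finite list \<Rightarrow> (real ^ 'p \<Rightarrow> real ^ 'q::finite) \<Rightarrow> real ^ 'p \<Rightarrow> real ^ 'q" where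
  "iter_partial [] u = u"
| "iter_partial (i # js) u = (\<lambda>x. frechet_derivative (iter_partial js u) (at x) (axis i 1))"

text \<open>
  Some ordering of \<open>J\<close> is chosen; for the smooth functions \<open>u\<close> to which this is applied, the
  derivative does not depend on the choice.
\<close>

definition partial :: "'p::finite multiset \<Rightarrow> (real ^ 'p \<Rightarrow> real ^ 'q::finite) \<Rightarrow> real ^ 'p \<Rightarrow> real ^ 'q" where
  "partial J u = iter_partial (SOME js. mset js = J) u"

definition prolong ::
    "(real ^ 'p::finite \<Rightarrow> real ^ 'q::finite) \<Rightarrow> real ^ 'p \<Rightarrow> ('p, 'q, 'n) jet_fibre" where
  "prolong u x = (\<chi> J. partial (Rep_jet_index J) u x)"


section \<open>Systems of differential equations\<close>

definition is_solution ::
    "((real ^ 'p::finite) \<times> (real ^ 'q::finite)) set \<Rightarrow> (('p, 'q, 'n::finite) jet \<Rightarrow> real ^ 'l::finite) \<Rightarrow>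
     (real ^ 'p) set \<Rightarrow> (real ^ 'p \<Rightarrow> real ^ 'q) \<Rightarrow> bool" where
  "is_solution M \<Delta> \<Omega> u \<longleftrightarrow>
     open \<Omega> \<and> smooth_on \<Omega> u \<and> (\<forall>x\<in>\<Omega>. (x, u x) \<in> M \<and> \<Delta> (x, prolong u x) = 0)"

definition zero_set ::
    "((real ^ 'p::finite) \<times> (real ^ 'q::finite)) set \<Rightarrow> (('p, 'q, 'n::finite) jet \<Rightarrow> real ^ 'l::finite) \<Rightarrow>
     ('p, 'q, 'n) jet set" where
  "zero_set M \<Delta> = {z \<in> jet_space M. \<Delta> z = 0}"

definition maximal_rank ::
    "((real ^ 'p::finite) \<times> (real ^ 'q::finite)) set \<Rightarrow> (('p, 'q, 'n::finite) jet \<Rightarrow> real ^ 'l::finite) \<Rightarrow> bool" where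
  "maximal_rank M \<Delta> \<longleftrightarrow>
     (\<forall>z\<in>zero_set M \<Delta>. dim (range (frechet_derivative \<Delta> (at z))) = CARD('l))"

definition locally_solvable ::
    "((real ^ 'p::finite) \<times> (real ^ 'q::finite)) set \<Rightarrow> (('p, 'q, 'n::finite) jet \<Rightarrow> real ^ 'l::finite) \<Rightarrow> bool" where
  "locally_solvable M \<Delta> \<longleftrightarrow>
     (\<forall>(x0, w0)\<in>zero_set M \<Delta>. \<exists>\<Omega> u. x0 \<in> \<Omega> \<and> is_solution M \<Delta> \<Omega> u \<and> prolong u x0 = w0)"

definition nondegenerate ::
    "((real ^ 'p::finite) \<times> (real ^ 'q::finite)) set \<Rightarrow> (('p, 'q, 'n::finite) jet \<Rightarrow> real ^ 'l::finite) \<Rightarrow> bool" where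
  "nondegenerate M \<Delta> \<longleftrightarrow> maximal_rank M \<Delta> \<and> locally_solvable M \<Delta>"


section \<open>One-parameter local transformation groups\<close>

text \<open>
  \<open>U\<close> is the domain of definition of the action: \<open>g \<eta> z\<close> is meaningful iff \<open>(\<eta>, z) \<in> U\<close>. The
  parameter interval carries the local group structure given by addition.
\<close>

definition local_transformation_group ::
    "real \<Rightarrow> 'a::euclidean_space set \<Rightarrow> (real \<times> 'a) set \<Rightarrow> (real \<Rightarrow> 'a \<Rightarrow> 'a) \<Rightarrow> bool" where
  "local_transformation_group \<eta>\<^sub>o M U g \<longleftrightarrow>
     0 < \<eta>\<^sub>o \<and> open M \<and> open U \<and>
     {0} \<times> M \<subseteq> U \<and> U \<subseteq> {-\<eta>\<^sub>o<..<\<eta>\<^sub>o} \<times> M \<and>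
     smooth_on U (\<lambda>(\<eta>, z). g \<eta> z) \<and>
     (\<forall>(\<eta>, z)\<in>U. g \<eta> z \<in> M) \<and>
     (\<forall>z\<in>M. g 0 z = z) \<and>
     (\<forall>\<eta> \<epsilon> z. (\<epsilon>, z) \<in> U \<and> (\<eta>, g \<epsilon> z) \<in> U \<and> (\<eta> + \<epsilon>, z) \<in> U \<longrightarrow> g \<eta> (g \<epsilon> z) = g (\<eta> + \<epsilon>) z) \<and>
     (\<forall>(\<eta>, z)\<in>U. (- \<eta>, g \<eta> z) \<in> U \<and> g (- \<eta>) (g \<eta> z) = z)"

definition graph_on :: "'a set \<Rightarrow> ('a \<Rightarrow> 'b) \<Rightarrow> ('a \<times> 'b) set" where
  "graph_on \<Omega> u = {(x, u x) | x. x \<in> \<Omega>}"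

text \<open>
  \<open>is_transform U g \<eta> \<Omega> u \<Omega>' u'\<close>: the transform of \<open>u : \<Omega> \<rightarrow> \<real>\<^sup>q\<close> under \<open>g \<eta>\<close> exists and is the smooth
  function \<open>u' : \<Omega>' \<rightarrow> \<real>\<^sup>q\<close>. Since \<open>g \<eta>\<close> is a partial map, the image of the graph of \<open>u\<close> is the
  image of that part of it on which \<open>g \<eta>\<close> is defined.
\<close>

definition is_transform ::
    "(real \<times> (real ^ 'p::finite) \<times> (real ^ 'q::finite)) set \<Rightarrow>
     (real \<Rightarrow> (real ^ 'p) \<times> (real ^ 'q) \<Rightarrow> (real ^ 'p) \<times> (real ^ 'q)) \<Rightarrow> real \<Rightarrow>
     (real ^ 'p) set \<Rightarrow> (real ^ 'p \<Rightarrow> real ^ 'q) \<Rightarrow>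
     (real ^ 'p) set \<Rightarrow> (real ^ 'p \<Rightarrow> real ^ 'q) \<Rightarrow> bool" where
  "is_transform U g \<eta> \<Omega> u \<Omega>' u' \<longleftrightarrow>
     open \<Omega>' \<and> smooth_on \<Omega>' u' \<and>
     graph_on \<Omega>' u' = g \<eta> ` {z \<in> graph_on \<Omega> u. (\<eta>, z) \<in> U}"

definition symmetry_group ::
    "((real ^ 'p::finite) \<times> (real ^ 'q::finite)) set \<Rightarrow> (('p, 'q, 'n::finite) jet \<Rightarrow> real ^ 'l::finite) \<Rightarrow>
     real \<Rightarrow> (real \<times> (real ^ 'p) \<times> (real ^ 'q)) set \<Rightarrow>
     (real \<Rightarrow> (real ^ 'p) \<times> (real ^ 'q) \<Rightarrow> (real ^ 'p) \<times> (real ^ 'q)) \<Rightarrow> bool" where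
  "symmetry_group M \<Delta> \<eta>\<^sub>o U g \<longleftrightarrow>
     local_transformation_group \<eta>\<^sub>o M U g \<and>
     (\<forall>\<eta> \<Omega> u \<Omega>' u'. \<eta> \<in> {-\<eta>\<^sub>o<..<\<eta>\<^sub>o} \<and> is_solution M \<Delta> \<Omega> u \<and> is_transform U g \<eta> \<Omega> u \<Omega>' u'
        \<longrightarrow> is_solution M \<Delta> \<Omega>' u')"

end

theory Submission
  imports Defs
begin

text \<open>
  Two facts carry the proof. The first is about prolongation: the jet of the transformed function
  \<open>g\<^sub>\<eta> u\<close> at the image point is a smooth function of \<open>\<eta>\<close> and of the jet of \<open>u\<close> alone. By the chain
  rule, if \<open>\<chi> x = \<Xi>\<^sub>\<eta> (x, u x)\<close>, then \<open>D\<^sub>k (w \<circ> \<chi>) = \<Sum>\<^sub>i (D\<^sub>k \<chi>\<^sub>i) (\<partial>\<^sub>i w \<circ> \<chi>)\<close>, so each new derivative of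
  \<open>g\<^sub>\<eta> u\<close> arises from the previous ones by total derivatives and by inverting the total Jacobian
  \<open>D\<^sub>k \<Xi>\<^sub>i\<close>. This recursion defines the prolonged action on the open set of those jets over the domain
  of the action at which the total Jacobian is invertible (\<open>prolonged_action_prolong\<close>). That set
  contains the jet of \<open>u\<close> at every point where the transform exists, because \<open>\<chi>\<close> then has the smooth
  inverse \<open>y \<mapsto> fst (g\<^sub>-\<^sub>\<eta> (y, g\<^sub>\<eta> u y))\<close> (\<open>prolonged_action_transform\<close>). Conversely, at such a jet
  the inverse function theorem makes the transform of a small piece of \<open>u\<close> exist
  (\<open>local_transform_exists\<close>).

  Put \<open>F (\<eta>, z) = \<Delta> (pr g\<^sub>\<eta> z)\<close>. If \<open>\<Delta> z = 0\<close>, local solvability gives a solution with jet \<open>z\<close>; a small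
  piece of it is transformed into another solution, so \<open>F (\<eta>, z) = 0\<close>
  (\<open>prolonged_action_preserves_zero_set\<close>).

  The second fact is a division theorem: a smooth function that vanishes wherever a smooth map \<open>D\<close>
  vanishes is a smooth linear combination of the components of \<open>D\<close>, provided that \<open>D\<close> is a submersion
  at its zeros (\<open>division_by_submersion\<close>). Near a zero, coordinates in which \<open>D\<close> is linear reduce this
  to Hadamard's lemma, that is, to the fundamental theorem of calculus along segments that end in the
  zero set. Away from the zeros \<open>f = (f / \<bar>D\<bar>\<^sup>2) D \<bullet> D\<close>. A partition of unity glues the local
  quotients. Applied to the components of \<open>F\<close> and to \<open>D (\<eta>, z) = \<Delta> z\<close>, this yields the multipliers \<open>Q\<close>.
\<close>

section \<open>Calculus of smooth maps\<close>

lemma Ck_on_subset: "Ck_on k S f \<Longrightarrow> T \<subseteq> S \<Longrightarrow> Ck_on k T f"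
  by (induction k arbitrary: f) (auto intro: continuous_on_subset)

lemma Ck_on_cong:
  assumes "open S" "\<And>x. x \<in> S \<Longrightarrow> f x = g x" "Ck_on k S f"
  shows "Ck_on k S g"
  using assms(2,3)
proof (induction k arbitrary: f g)
  case 0
  then show ?case by (auto simp: continuous_on_eq)
next
  case (Suc k)
  have der: "(g has_derivative frechet_derivative f (at x)) (at x)" if "x \<in> S" for x
    by (rule has_derivative_transform_within_open[OF _ \<open>open S\<close> that, of f])
       (use Suc.prems that in \<open>auto simp: frechet_derivative_works[symmetric]\<close>)
  have eq: "frechet_derivative f (at x) = frechet_derivative g (at x)" if "x \<in> S" for x
    by (rule frechet_derivative_at[OF der[OF that]])
  have "Ck_on k S (\<lambda>x. frechet_derivative g (at x) v)" for v
  proof (rule Suc.IH)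
    show "Ck_on k S (\<lambda>x. frechet_derivative f (at x) v)" using Suc.prems(2) by simp
  qed (simp only: eq)
  then show ?case
    using der by (auto simp: differentiable_def)
qed

text \<open>
  The induction step of all closure properties: it needs a formula for the derivative, valid on the
  open set only, instead of the total function \<open>frechet_derivative\<close>.
\<close>

lemma Ck_on_derivI:
  assumes "open S" and der: "\<And>x. x \<in> S \<Longrightarrow> (f has_derivative f' x) (at x)"
    and "\<And>v. Ck_on k S (\<lambda>x. f' x v)"
  shows "Ck_on (Suc k) S f"
proof -
  have "f' x = frechet_derivative f (at x)" if "x \<in> S" for x
    by (rule frechet_derivative_at[OF der[OF that]])
  then have "Ck_on k S (\<lambda>x. frechet_derivative f (at x) v)" for v
    by (intro Ck_on_cong[OF \<open>open S\<close> _ assms(3)]) simp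
  then show ?thesis
    using der by (auto simp: differentiable_def)
qed

lemma Ck_on_SucD:
  assumes "Ck_on (Suc k) S f" shows "Ck_on k S f"
  using assms
proof (induction k arbitrary: f)
  case 0
  then show ?case
    by (auto intro: differentiable_imp_continuous_within continuous_at_imp_continuous_on)
qed auto

lemma Ck_on_has_derivative:
  "Ck_on (Suc k) S f \<Longrightarrow> x \<in> S \<Longrightarrow> (f has_derivative frechet_derivative f (at x)) (at x)"
  by (simp add: frechet_derivative_works[symmetric])

lemma Ck_on_local:
  assumes "\<And>x. x \<in> S \<Longrightarrow> \<exists>T. open T \<and> x \<in> T \<and> Ck_on k T f"
  shows "Ck_on k S f"
  using assms
proof (induction k arbitrary: f)
  case 0
  show ?case
    unfolding Ck_on.simps
    by (rule continuous_at_imp_continuous_on)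
       (use 0 continuous_on_eq_continuous_at in \<open>fastforce\<close>)
next
  case (Suc k)
  have "f differentiable (at x)" if "x \<in> S" for x
    using Suc.prems[OF that] by auto
  moreover have "Ck_on k S (\<lambda>x. frechet_derivative f (at x) v)" for v
  proof (rule Suc.IH)
    fix x assume "x \<in> S"
    from Suc.prems[OF this]
    show "\<exists>T. open T \<and> x \<in> T \<and> Ck_on k T (\<lambda>x. frechet_derivative f (at x) v)" by auto
  qed
  ultimately show ?case by simp
qed

lemma Ck_on_const: "Ck_on k S (\<lambda>x. c)"
proof (induction k arbitrary: c)
  case (Suc k)
  have "frechet_derivative (\<lambda>x. c) (at x) = (\<lambda>v. 0)" for x :: 'a
    by (metis frechet_derivative_at has_derivative_const)
  then show ?case using Suc by simp
qed simp

lemma Ck_on_bounded_linear: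
  assumes "bounded_linear f" shows "Ck_on k S f"
proof (cases k)
  case 0
  then show ?thesis using assms by (simp add: linear_continuous_on)
next
  case (Suc m)
  have "frechet_derivative f (at x) = f" for x
    by (metis assms frechet_derivative_at bounded_linear_imp_has_derivative)
  then show ?thesis
    using Suc assms by (simp add: Ck_on_const bounded_linear_imp_differentiable)
qed

lemma Ck_on_add:
  assumes "open S" "Ck_on k S f" "Ck_on k S g"
  shows "Ck_on k S (\<lambda>x. f x + g x)"
  using assms(2,3)
proof (induction k arbitrary: f g)
  case 0
  then show ?case by (auto intro: continuous_intros)
next
  case (Suc k)
  show ?case
    by (rule Ck_on_derivI[OF \<open>open S\<close> has_derivative_add[OF Ck_on_has_derivative Ck_on_has_derivative]])
       (use Suc in auto)
qed

lemma Ck_on_sum: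
  assumes "open S" "\<And>i. i \<in> I \<Longrightarrow> Ck_on k S (f i)"
  shows "Ck_on k S (\<lambda>x. \<Sum>i\<in>I. f i x)"
  using assms(2)
  by (induction I rule: infinite_finite_induct) (auto intro: Ck_on_const Ck_on_add[OF \<open>open S\<close>])

lemma Ck_on_bilinear:
  assumes "open S" "bounded_bilinear p" "Ck_on k S f" "Ck_on k S g"
  shows "Ck_on k S (\<lambda>x. p (f x) (g x))"
  using assms(3,4)
proof (induction k arbitrary: f g)
  case 0
  then show ?case by (auto intro: bounded_bilinear.continuous_on[OF assms(2)])
next
  case (Suc k)
  have "Ck_on k S f" "Ck_on k S g"
    "Ck_on k S (\<lambda>x. frechet_derivative f (at x) v)" "Ck_on k S (\<lambda>x. frechet_derivative g (at x) v)" for v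
    using Suc.prems Ck_on_SucD by auto
  then show ?case
    by (intro Ck_on_derivI[OF \<open>open S\<close>
            bounded_bilinear.FDERIV[OF assms(2) Ck_on_has_derivative[OF Suc.prems(1)]
              Ck_on_has_derivative[OF Suc.prems(2)]]]
          Ck_on_add[OF \<open>open S\<close>] Suc.IH)
qed

lemma Ck_on_componentsI:
  fixes f :: "'a::real_normed_vector \<Rightarrow> 'b::euclidean_space"
  assumes "open S" "\<And>b. b \<in> Basis \<Longrightarrow> Ck_on k S (\<lambda>x. f x \<bullet> b)"
  shows "Ck_on k S f"
proof -
  have "Ck_on k S (\<lambda>x. \<Sum>b\<in>Basis. (f x \<bullet> b) *\<^sub>R b)"
    using assms by (intro Ck_on_sum Ck_on_bilinear[OF _ bounded_bilinear_scaleR] Ck_on_const) auto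
  then show ?thesis by (simp add: euclidean_representation)
qed

lemma Ck_on_compose:
  fixes f :: "'b::euclidean_space \<Rightarrow> 'c::real_normed_vector"
  assumes "open S" "open T" "Ck_on k T f" "Ck_on k S g" "g ` S \<subseteq> T"
  shows "Ck_on k S (\<lambda>x. f (g x))"
  using assms(3,4)
proof (induction k arbitrary: f)
  case 0
  then show ?case using \<open>g ` S \<subseteq> T\<close> by (auto intro: continuous_on_compose2)
next
  case (Suc k)
  let ?D = "\<lambda>x. frechet_derivative f (at (g x))" and ?E = "\<lambda>x. frechet_derivative g (at x)"
  have der: "((\<lambda>x. f (g x)) has_derivative (\<lambda>v. ?D x (?E x v))) (at x)" if "x \<in> S" for x
    by (rule has_derivative_compose[where f = g and g = f,
          OF Ck_on_has_derivative[OF Suc.prems(2) that] Ck_on_has_derivative[OF Suc.prems(1)]])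
       (use that \<open>g ` S \<subseteq> T\<close> in auto)
  have "?D x (?E x v) = (\<Sum>b\<in>Basis. (?E x v \<bullet> b) *\<^sub>R ?D x b)" if "x \<in> S" for x v
  proof -
    have "linear (?D x)"
      using that Suc.prems(1) \<open>g ` S \<subseteq> T\<close>
      by (intro has_derivative_linear[OF Ck_on_has_derivative]) auto
    then have "?D x (\<Sum>b\<in>Basis. (?E x v \<bullet> b) *\<^sub>R b) = (\<Sum>b\<in>Basis. (?E x v \<bullet> b) *\<^sub>R ?D x b)"
      by (simp add: linear_sum linear_scale)
    then show ?thesis by (simp add: euclidean_representation)
  qed
  then have der': "((\<lambda>x. f (g x)) has_derivative (\<lambda>v. \<Sum>b\<in>Basis. (?E x v \<bullet> b) *\<^sub>R ?D x b)) (at x)"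
    if "x \<in> S" for x using der[OF that] that by simp
  have g: "Ck_on k S (\<lambda>x. ?E x v)" "Ck_on k S g" for v
    using Suc.prems(2) Ck_on_SucD by auto
  show ?case
    using Suc.prems(1) g Suc.IH
    by (intro Ck_on_derivI[OF \<open>open S\<close> der'] Ck_on_sum[OF \<open>open S\<close>]
          Ck_on_bilinear[OF \<open>open S\<close> bounded_bilinear_scaleR]
          Ck_on_bilinear[OF \<open>open S\<close> bounded_bilinear_inner] Ck_on_const) auto
qed

lemma smooth_on_subset: "smooth_on S f \<Longrightarrow> T \<subseteq> S \<Longrightarrow> smooth_on T f"
  unfolding smooth_on_def using Ck_on_subset by blast

lemma smooth_on_cong:
  "open S \<Longrightarrow> (\<And>x. x \<in> S \<Longrightarrow> f x = g x) \<Longrightarrow> smooth_on S f \<Longrightarrow> smooth_on S g"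
  unfolding smooth_on_def using Ck_on_cong by blast

lemma smooth_on_local:
  assumes "\<And>x. x \<in> S \<Longrightarrow> \<exists>T. open T \<and> x \<in> T \<and> smooth_on T f"
  shows "smooth_on S f"
  unfolding smooth_on_def
proof
  fix k show "Ck_on k S f"
    by (rule Ck_on_local, drule assms) (auto simp: smooth_on_def)
qed

lemma smooth_on_const [simp]: "smooth_on S (\<lambda>x. c)"
  by (simp add: smooth_on_def Ck_on_const)

lemma smooth_on_bounded_linear: "bounded_linear f \<Longrightarrow> smooth_on S f"
  by (simp add: smooth_on_def Ck_on_bounded_linear)

lemma smooth_on_id [simp]: "smooth_on S (\<lambda>x. x)"
  by (simp add: smooth_on_bounded_linear)

lemma smooth_on_add: "open S \<Longrightarrow> smooth_on S f \<Longrightarrow> smooth_on S g \<Longrightarrow> smooth_on S (\<lambda>x. f x + g x)"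
  by (simp add: smooth_on_def Ck_on_add)

lemma smooth_on_sum:
  "open S \<Longrightarrow> (\<And>i. i \<in> I \<Longrightarrow> smooth_on S (f i)) \<Longrightarrow> smooth_on S (\<lambda>x. \<Sum>i\<in>I. f i x)"
  by (simp add: smooth_on_def Ck_on_sum)

lemma smooth_on_bilinear:
  "open S \<Longrightarrow> bounded_bilinear p \<Longrightarrow> smooth_on S f \<Longrightarrow> smooth_on S g \<Longrightarrow> smooth_on S (\<lambda>x. p (f x) (g x))"
  by (simp add: smooth_on_def Ck_on_bilinear)

lemmas smooth_on_scaleR = smooth_on_bilinear[OF _ bounded_bilinear_scaleR]
  and smooth_on_inner = smooth_on_bilinear[OF _ bounded_bilinear_inner]
  and smooth_on_mult = smooth_on_bilinear[OF _ bounded_bilinear_mult]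

lemma smooth_on_compose:
  fixes f :: "'b::euclidean_space \<Rightarrow> 'c::real_normed_vector"
  shows "open S \<Longrightarrow> open T \<Longrightarrow> smooth_on T f \<Longrightarrow> smooth_on S g \<Longrightarrow> g ` S \<subseteq> T
    \<Longrightarrow> smooth_on S (\<lambda>x. f (g x))"
  by (simp add: smooth_on_def Ck_on_compose)

lemma smooth_on_linear_compose:
  fixes g :: "'a::real_normed_vector \<Rightarrow> 'b::euclidean_space"
  shows "open S \<Longrightarrow> bounded_linear f \<Longrightarrow> smooth_on S g \<Longrightarrow> smooth_on S (\<lambda>x. f (g x))"
  by (rule smooth_on_compose[OF _ open_UNIV smooth_on_bounded_linear]) auto

lemma smooth_on_minus:
  fixes f :: "'a::real_normed_vector \<Rightarrow> 'b::euclidean_space"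
  shows "open S \<Longrightarrow> smooth_on S f \<Longrightarrow> smooth_on S (\<lambda>x. - f x)"
  by (rule smooth_on_linear_compose) (auto intro: bounded_linear_minus)

lemma smooth_on_diff:
  fixes f :: "'a::real_normed_vector \<Rightarrow> 'b::euclidean_space"
  shows "open S \<Longrightarrow> smooth_on S f \<Longrightarrow> smooth_on S g \<Longrightarrow> smooth_on S (\<lambda>x. f x - g x)"
  using smooth_on_add[OF _ _ smooth_on_minus, of S f g] by simp

lemma smooth_on_componentsI:
  fixes f :: "'a::real_normed_vector \<Rightarrow> 'b::euclidean_space"
  shows "open S \<Longrightarrow> (\<And>b. b \<in> Basis \<Longrightarrow> smooth_on S (\<lambda>x. f x \<bullet> b)) \<Longrightarrow> smooth_on S f"
  by (simp add: smooth_on_def Ck_on_componentsI)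

lemma smooth_on_Pair:
  fixes f :: "'a::real_normed_vector \<Rightarrow> 'b::euclidean_space"
    and g :: "'a \<Rightarrow> 'c::euclidean_space"
  assumes "open S" "smooth_on S f" "smooth_on S g"
  shows "smooth_on S (\<lambda>x. (f x, g x))"
proof (rule smooth_on_componentsI[OF \<open>open S\<close>])
  fix b :: "'b \<times> 'c"
  show "smooth_on S (\<lambda>x. (f x, g x) \<bullet> b)"
    unfolding inner_prod_def fst_conv snd_conv
    using assms by (intro smooth_on_add smooth_on_inner smooth_on_const)
qed

lemma smooth_on_fst:
  fixes f :: "'a::real_normed_vector \<Rightarrow> 'b::euclidean_space \<times> 'c::euclidean_space"
  shows "open S \<Longrightarrow> smooth_on S f \<Longrightarrow> smooth_on S (\<lambda>x. fst (f x))"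
  by (rule smooth_on_linear_compose[OF _ bounded_linear_fst])

lemma smooth_on_snd:
  fixes f :: "'a::real_normed_vector \<Rightarrow> 'b::euclidean_space \<times> 'c::euclidean_space"
  shows "open S \<Longrightarrow> smooth_on S f \<Longrightarrow> smooth_on S (\<lambda>x. snd (f x))"
  by (rule smooth_on_linear_compose[OF _ bounded_linear_snd])

lemma smooth_on_vec_nth:
  fixes f :: "'a::real_normed_vector \<Rightarrow> 'b::euclidean_space ^ 'n::finite"
  shows "open S \<Longrightarrow> smooth_on S f \<Longrightarrow> smooth_on S (\<lambda>x. f x $ i)"
  by (rule smooth_on_linear_compose[OF _ bounded_linear_vec_nth])

lemma smooth_on_vec_lambda:
  fixes f :: "'n::finite \<Rightarrow> 'a::real_normed_vector \<Rightarrow> 'b::euclidean_space"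
  assumes "open S" "\<And>i. smooth_on S (f i)"
  shows "smooth_on S (\<lambda>x. \<chi> i. f i x)"
proof (rule smooth_on_componentsI[OF \<open>open S\<close>])
  fix b :: "'b ^ 'n"
  show "smooth_on S (\<lambda>x. (\<chi> i. f i x) \<bullet> b)"
    unfolding inner_vec_def vec_lambda_beta
    using assms by (intro smooth_on_sum smooth_on_inner smooth_on_const)
qed

lemma smooth_on_has_derivative:
  "smooth_on S f \<Longrightarrow> x \<in> S \<Longrightarrow> (f has_derivative frechet_derivative f (at x)) (at x)"
  unfolding smooth_on_def using Ck_on_has_derivative by blast

lemma smooth_on_continuous_on: "smooth_on S f \<Longrightarrow> continuous_on S f"
  unfolding smooth_on_def using Ck_on.simps(1) by blast

lemma smooth_on_linear_derivative:
  "smooth_on S f \<Longrightarrow> x \<in> S \<Longrightarrow> linear (frechet_derivative f (at x))"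
  using has_derivative_linear smooth_on_has_derivative by blast

lemma smooth_on_directional_derivative:
  "smooth_on S f \<Longrightarrow> smooth_on S (\<lambda>x. frechet_derivative f (at x) v)"
  unfolding smooth_on_def by (metis Ck_on.simps(2))

text \<open>
  Smoothness is defined through derivatives in constant directions; expanding the direction in the
  basis covers directions that vary smoothly.
\<close>

lemma smooth_on_derivative_apply:
  fixes f :: "'a::euclidean_space \<Rightarrow> 'b::euclidean_space"
  assumes "open S" "smooth_on S f" "smooth_on S h"
  shows "smooth_on S (\<lambda>x. frechet_derivative f (at x) (h x))"
proof (rule smooth_on_cong[OF \<open>open S\<close>])
  show "smooth_on S (\<lambda>x. \<Sum>b\<in>Basis. (h x \<bullet> b) *\<^sub>R frechet_derivative f (at x) b)"
    using assms
    by (intro smooth_on_sum smooth_on_scaleR smooth_on_inner smooth_on_directional_derivative) auto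
next
  fix x assume "x \<in> S"
  then have "linear (frechet_derivative f (at x))"
    using assms smooth_on_linear_derivative by blast
  then have "(\<Sum>b\<in>Basis. (h x \<bullet> b) *\<^sub>R frechet_derivative f (at x) b)
      = frechet_derivative f (at x) (\<Sum>b\<in>Basis. (h x \<bullet> b) *\<^sub>R b)"
    by (simp add: linear_sum linear_scale)
  then show "(\<Sum>b\<in>Basis. (h x \<bullet> b) *\<^sub>R frechet_derivative f (at x) b) = frechet_derivative f (at x) (h x)"
    by (simp add: euclidean_representation)
qed

text \<open>
  Differentiability of the inverse family comes from the derivative of the inverse of the map
  \<open>(y, w) \<mapsto> (y, L y w)\<close>; smoothness then follows from
  \<open>D (L\<inverse> v) = - L\<inverse> (D L) (L\<inverse> v)\<close> by induction on the order.
\<close>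

lemma smooth_on_inverse_family:
  fixes L :: "'a::euclidean_space \<Rightarrow> 'b::euclidean_space \<Rightarrow> 'b"
  assumes "open S" and lin: "\<And>y. y \<in> S \<Longrightarrow> linear (L y)" and bij: "\<And>y. y \<in> S \<Longrightarrow> bij (L y)"
    and smooth: "\<And>w. smooth_on S (\<lambda>y. L y w)"
  shows "smooth_on S (\<lambda>y. inv (L y) v)"
proof -
  define dL where "dL = (\<lambda>y h w. \<Sum>b\<in>Basis. (w \<bullet> b) *\<^sub>R frechet_derivative (\<lambda>y. L y b) (at y) h)"
  have L_expand: "L y w = (\<Sum>b\<in>Basis. (w \<bullet> b) *\<^sub>R L y b)" if "y \<in> S" for y w
  proof -
    have "L y (\<Sum>b\<in>Basis. (w \<bullet> b) *\<^sub>R b) = (\<Sum>b\<in>Basis. (w \<bullet> b) *\<^sub>R L y b)"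
      using lin[OF that] by (simp add: linear_sum linear_scale)
    then show ?thesis by (simp add: euclidean_representation)
  qed
  have lin_inv: "linear (inv (L y))" if "y \<in> S" for y
    using that lin bij by (simp add: bij_is_inj inj_linear_imp_inv_linear)
  have der: "((\<lambda>y. inv (L y) v) has_derivative (\<lambda>h. - inv (L y) (dL y h (inv (L y) v)))) (at y)"
    if y: "y \<in> S" for y v
  proof -
    define F where "F = (\<lambda>(y, w). (y, L y w))"
    define F' where "F' = (\<lambda>(y, w) (h, k). (h, dL y h w + L y k))"
    define G where "G = (\<lambda>(y, v). (y, inv (L y) v))"
    define G' where "G' = (\<lambda>(y, w) (h, k). (h, inv (L y) (k - dL y h w)))"
    have "(F has_derivative F' z) (at z)" if z: "z \<in> S \<times> UNIV" for z
    proof -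
      obtain y w where zyw: "z = (y, w)" and y: "y \<in> S" using z by auto
      let ?H = "\<lambda>z. (fst z, \<Sum>b\<in>Basis. (snd z \<bullet> b) *\<^sub>R L (fst z) b)"
      have Ld: "((\<lambda>z. L (fst z) b) has_derivative (\<lambda>k. frechet_derivative (\<lambda>y. L y b) (at y) (fst k))) (at z)" for b
        using smooth_on_has_derivative[OF smooth y] zyw
        by (intro has_derivative_compose[OF has_derivative_fst[OF has_derivative_ident]]) auto
      have "(?H has_derivative (\<lambda>k. (fst k, \<Sum>b\<in>Basis. (snd z \<bullet> b) *\<^sub>R frechet_derivative (\<lambda>y. L y b) (at y) (fst k)
              + (snd k \<bullet> b) *\<^sub>R L (fst z) b))) (at z)"
        by (auto intro!: derivative_eq_intros Ld)
      also have "(\<lambda>k. (fst k, \<Sum>b\<in>Basis. (snd z \<bullet> b) *\<^sub>R frechet_derivative (\<lambda>y. L y b) (at y) (fst k)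
              + (snd k \<bullet> b) *\<^sub>R L (fst z) b)) = F' z"
        by (auto simp: F'_def zyw dL_def fun_eq_iff sum.distrib L_expand[OF y, symmetric])
      finally show ?thesis
        by (rule has_derivative_transform_within_open[where s = "S \<times> UNIV"])
           (use z \<open>open S\<close> in \<open>auto simp: F_def L_expand[symmetric] open_Times\<close>)
    qed
    moreover have "G (F z) = z" if "z \<in> S \<times> UNIV" for z
      using that bij by (auto simp: F_def G_def bij_is_inj)
    moreover have "F' (y, inv (L y) v) \<circ> G' (y, inv (L y) v) = id"
      using bij[OF y] by (auto simp: F'_def G'_def fun_eq_iff bij_is_surj surj_f_inv_f)
    ultimately have "(G has_derivative G' (y, inv (L y) v)) (at (F (y, inv (L y) v)))"
      using y
      by (intro has_derivative_inverse_on[OF open_Times[OF \<open>open S\<close> open_UNIV], where f = F and f' = F'])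
         auto
    then have "(G has_derivative G' (y, inv (L y) v)) (at (y, v))"
      using bij[OF y] by (simp add: F_def bij_is_surj surj_f_inv_f)
    then have "((\<lambda>y. snd (G (y, v))) has_derivative (\<lambda>h. snd (G' (y, inv (L y) v) (h, 0)))) (at y)"
      by (intro has_derivative_snd has_derivative_compose[where g = G and f = "\<lambda>y. (y, v)"])
         (auto intro!: derivative_eq_intros)
    then show ?thesis
      using lin_inv[OF y] by (simp add: G_def G'_def linear_neg)
  qed
  have "Ck_on k S (\<lambda>y. inv (L y) v)" for k v
  proof (induction k arbitrary: v)
    case 0
    show ?case
      using der by (auto intro!: continuous_at_imp_continuous_on intro: has_derivative_continuous)
  next
    case (Suc k)
    have dL_Ck: "Ck_on k S (\<lambda>y. dL y h (inv (L y) v))" for h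
      unfolding dL_def
      using Suc smooth_on_directional_derivative[OF smooth]
      by (intro Ck_on_sum[OF \<open>open S\<close>] Ck_on_bilinear[OF \<open>open S\<close> bounded_bilinear_scaleR]
          Ck_on_bilinear[OF \<open>open S\<close> bounded_bilinear_inner] Ck_on_const)
         (auto simp: smooth_on_def)
    have "Ck_on k S (\<lambda>y. - inv (L y) (dL y h (inv (L y) v)))" for h
    proof (rule Ck_on_cong[OF \<open>open S\<close>])
      show "Ck_on k S (\<lambda>y. (- 1) *\<^sub>R (\<Sum>b\<in>Basis. (dL y h (inv (L y) v) \<bullet> b) *\<^sub>R inv (L y) b))"
        by (intro Ck_on_sum[OF \<open>open S\<close>] Ck_on_bilinear[OF \<open>open S\<close> bounded_bilinear_scaleR]
          Ck_on_bilinear[OF \<open>open S\<close> bounded_bilinear_inner] Ck_on_const Suc.IH dL_Ck)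
    next
      fix y assume "y \<in> S"
      let ?w = "dL y h (inv (L y) v)"
      have "inv (L y) (\<Sum>b\<in>Basis. (?w \<bullet> b) *\<^sub>R b) = (\<Sum>b\<in>Basis. (?w \<bullet> b) *\<^sub>R inv (L y) b)"
        using lin_inv[OF \<open>y \<in> S\<close>] by (simp add: linear_sum linear_scale)
      then show "(- 1) *\<^sub>R (\<Sum>b\<in>Basis. (?w \<bullet> b) *\<^sub>R inv (L y) b) = - inv (L y) ?w"
        by (simp add: euclidean_representation)
    qed
    note step = this
    show ?case
      by (rule Ck_on_derivI[OF \<open>open S\<close> der step])
  qed
  then show ?thesis by (simp add: smooth_on_def)
qed

lemma smooth_on_divide:
  fixes f g :: "'a::euclidean_space \<Rightarrow> real"
  assumes "open S" "smooth_on S f" "smooth_on S g" "\<And>x. x \<in> S \<Longrightarrow> g x \<noteq> 0"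
  shows "smooth_on S (\<lambda>x. f x / g x)"
proof -
  have bij: "bij (\<lambda>w. g y * w)" if "y \<in> S" for y
    using assms(4)[OF that] by (intro o_bij[of "\<lambda>w. w / g y"]) auto
  have lin: "linear (\<lambda>w. g y * w)" for y
    by (rule linear_times)
  have "smooth_on S (\<lambda>y. inv (\<lambda>w. g y * w) 1)"
    by (rule smooth_on_inverse_family[OF \<open>open S\<close> lin bij smooth_on_mult[OF \<open>open S\<close> assms(3) smooth_on_const]])
  moreover have "inv (\<lambda>w. g y * w) 1 = 1 / g y" if "y \<in> S" for y
    using bij[OF that] assms(4)[OF that] by (intro inv_f_eq) (auto simp: bij_is_inj)
  ultimately have "smooth_on S (\<lambda>x. 1 / g x)"
    by (rule smooth_on_cong[OF \<open>open S\<close>, rotated])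
  then have "smooth_on S (\<lambda>x. f x * (1 / g x))"
    by (rule smooth_on_mult[OF assms(1,2)])
  then show ?thesis by simp
qed

section \<open>The smooth inverse function theorem\<close>

text \<open>
  The inverse \<open>g\<close> supplied by the \<open>C\<^sup>1\<close> inverse function theorem satisfies
  \<open>g' y = (f' (g y))\<inverse>\<close>, and \<open>x \<mapsto> (f' x)\<inverse>\<close> is smooth, so \<open>g\<close> gains one order of differentiability at
  each step.
\<close>

theorem smooth_inverse_function:
  fixes f :: "'a::euclidean_space \<Rightarrow> 'a"
  assumes "open U" and f: "smooth_on U f" and "x0 \<in> U"
    and inj: "inj (frechet_derivative f (at x0))"
  obtains U' V g where "open U'" "U' \<subseteq> U" "x0 \<in> U'" "open V" "f x0 \<in> V"
    "homeomorphism U' V f g" "smooth_on V g"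
proof -
  let ?L = "\<lambda>x. frechet_derivative f (at x)"
  define f' where "f' x = Blinfun (?L x)" for x
  have f'_apply: "blinfun_apply (f' x) = ?L x" if "x \<in> U" for x
    using smooth_on_has_derivative[OF f that]
    by (simp add: f'_def bounded_linear_Blinfun_apply has_derivative_bounded_linear)
  have der: "(f has_derivative blinfun_apply (f' x)) (at x)" if "x \<in> U" for x
    using smooth_on_has_derivative[OF f that] f'_apply[OF that] by simp
  have contf': "continuous_on U f'"
  proof (rule continuous_on_blinfun_componentwise)
    fix i :: 'a
    have "continuous_on U (\<lambda>x. ?L x i)"
      by (rule smooth_on_continuous_on[OF smooth_on_directional_derivative[OF f]])
    then show "continuous_on U (\<lambda>x. blinfun_apply (f' x) i)"
      by (rule continuous_on_eq) (simp add: f'_apply)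
  qed
  have lin: "linear (?L x0)"
    by (rule smooth_on_linear_derivative[OF f \<open>x0 \<in> U\<close>])
  then have "linear (inv (?L x0))"
    using inj by (rule inj_linear_imp_inv_linear)
  then have invf: "Blinfun (inv (?L x0)) o\<^sub>L f' x0 = id_blinfun"
    using inj f'_apply[OF \<open>x0 \<in> U\<close>]
    by (intro blinfun_eqI) (simp add: bounded_linear_Blinfun_apply linear_conv_bounded_linear)
  obtain U' V g g' where U': "open U'" "U' \<subseteq> U" "x0 \<in> U'" and V: "open V" "f x0 \<in> V"
    and hom: "homeomorphism U' V f g"
    and g: "\<And>y. y \<in> V \<Longrightarrow> (g has_derivative (g' y)) (at y)"
    and g': "\<And>y. y \<in> V \<Longrightarrow> g' y = inv (blinfun_apply (f' (g y)))"
    and bij: "\<And>y. y \<in> V \<Longrightarrow> bij (blinfun_apply (f' (g y)))"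
    using inverse_function_theorem[OF \<open>open U\<close> der contf' \<open>x0 \<in> U\<close> invf] by blast
  have gV: "g y \<in> U'" "f (g y) = y" if "y \<in> V" for y
    using hom that by (auto simp: homeomorphism_def)
  have fU: "f x \<in> V" "g (f x) = x" if "x \<in> U'" for x
    using hom that by (auto simp: homeomorphism_def)
  have g_der: "(g has_derivative inv (?L (g y))) (at y)" if "y \<in> V" for y
    using g[OF that] g'[OF that] f'_apply[of "g y"] gV[OF that] U'(2) by auto
  have bij': "bij (?L x)" if "x \<in> U'" for x
    using bij[OF fU(1)[OF that]] fU(2)[OF that] f'_apply[of x] U'(2) that by auto
  have "smooth_on U' (\<lambda>x. inv (?L x) v)" for v
  proof (rule smooth_on_inverse_family[OF U'(1) _ bij'])
    show "linear (?L y)" if "y \<in> U'" for y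
      using that U'(2) f smooth_on_linear_derivative by blast
    show "smooth_on U' (\<lambda>y. ?L y w)" for w
      by (rule smooth_on_subset[OF smooth_on_directional_derivative[OF f] U'(2)])
  qed
  then have inv_Ck: "Ck_on k U' (\<lambda>x. inv (?L x) v)" for k v
    by (simp add: smooth_on_def)
  have "Ck_on k V g" for k
  proof (induction k)
    case 0
    show ?case using hom by (simp add: homeomorphism_def)
  next
    case (Suc k)
    have step: "Ck_on k V (\<lambda>y. inv (?L (g y)) v)" for v
      by (rule Ck_on_compose[OF V(1) U'(1) inv_Ck Suc.IH]) (use gV in auto)
    show ?case
      by (rule Ck_on_derivI[OF V(1) g_der step])
  qed
  then have "smooth_on V g" by (simp add: smooth_on_def)
  with U' V hom that show ?thesis by blast
qed

section \<open>Division by a submersion\<close>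

text \<open>
  Differentiation under the integral sign turns a directional derivative of the integral into the
  integral of another smooth integrand, so differentiability of all such integrals already gives
  smoothness, by induction on the order.
\<close>

lemma smooth_on_integral:
  fixes H :: "'a::euclidean_space \<times> real \<Rightarrow> 'b::euclidean_space"
  assumes "open T" "convex T" "open N" "T \<times> {0..1} \<subseteq> N" "smooth_on N H"
  shows "smooth_on T (\<lambda>y. integral {0..1} (\<lambda>s. H (y, s)))"
proof -
  let ?I = "\<lambda>H y. integral {0..1} (\<lambda>s. H (y, s))"
  let ?d = "\<lambda>H h z. frechet_derivative H (at z) (h, 0)"
  have der: "(?I H has_derivative (\<lambda>h. ?I (?d H h) y)) (at y)"
    if H: "smooth_on N H" and y: "y \<in> T" for H :: "'a \<times> real \<Rightarrow> 'b" and y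
  proof -
    define fx where "fx y s = Blinfun (\<lambda>h. ?d H h (y, s))" for y s
    have bl: "bounded_linear (\<lambda>h. ?d H h (y, s))" if "y \<in> T" "s \<in> {0..1}" for y s
    proof (rule bounded_linear_compose[where g = "\<lambda>h. (h, 0 :: real)"])
      show "bounded_linear (frechet_derivative H (at (y, s)))"
        using smooth_on_has_derivative[OF H] that assms(4) has_derivative_bounded_linear by blast
    qed (intro bounded_linear_Pair bounded_linear_ident bounded_linear_zero)
    have fx_apply: "blinfun_apply (fx y s) = (\<lambda>h. ?d H h (y, s))" if "y \<in> T" "s \<in> {0..1}" for y s
      unfolding fx_def by (rule bounded_linear_Blinfun_apply[OF bl[OF that]])
    have 1: "((\<lambda>y. H (y, s)) has_derivative blinfun_apply (fx y s)) (at y within T)"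
      if "y \<in> T" "s \<in> cbox 0 1" for y s
    proof -
      have Hd: "(H has_derivative frechet_derivative H (at (y, s))) (at (y, s))"
        using that assms(4) by (intro smooth_on_has_derivative[OF H]) auto
      have "((\<lambda>y. H (y, s)) has_derivative (\<lambda>h. ?d H h (y, s))) (at y)"
        by (rule has_derivative_compose[where g = H and f = "\<lambda>y. (y, s)", OF _ Hd])
           (auto intro!: derivative_eq_intros)
      then show ?thesis
        using that fx_apply[of y s] by (auto intro: has_derivative_at_withinI)
    qed
    have cont: "continuous_on {0..1} (\<lambda>s. G (y, s))" if "smooth_on N G" "y \<in> T" for G :: "'a \<times> real \<Rightarrow> 'b" and y
      by (rule continuous_on_compose2[OF smooth_on_continuous_on[OF that(1)]])
         (use that(2) assms(4) in \<open>auto intro!: continuous_intros\<close>)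
    have 2: "(\<lambda>s. H (y, s)) integrable_on cbox 0 1" if "y \<in> T" for y
      using cont[OF H that] by (intro integrable_continuous) simp
    have 3: "continuous_on (T \<times> cbox 0 1) (\<lambda>(y, s). fx y s)"
    proof (rule continuous_on_blinfun_componentwise)
      fix i :: 'a
      have "continuous_on (T \<times> cbox 0 1) (?d H i)"
        using assms(4)
        by (intro continuous_on_subset[OF smooth_on_continuous_on[OF smooth_on_directional_derivative[OF H]]]) auto
      then show "continuous_on (T \<times> cbox 0 1) (\<lambda>x. blinfun_apply (case x of (y, s) \<Rightarrow> fx y s) i)"
        by (rule continuous_on_eq) (auto simp: fx_apply)
    qed
    have "(?I H has_derivative blinfun_apply (integral (cbox 0 1) (fx y))) (at y within T)"
      using leibniz_rule[where f = "\<lambda>y s. H (y, s)" and fx = fx, OF 1 2 3 y \<open>convex T\<close>] by simp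
    moreover have "blinfun_apply (integral (cbox 0 1) (fx y)) h = ?I (?d H h) y" for h
    proof -
      have "continuous_on (cbox 0 1) (fx y)"
        using y continuous_on_compose2[OF 3, of "cbox 0 1" "\<lambda>s. (y, s)"]
          continuous_on_Pair[OF continuous_on_const continuous_on_id, of "{0..1}" y]
        by auto
      then have "blinfun_apply (integral (cbox 0 1) (fx y)) h = integral (cbox 0 1) (\<lambda>s. blinfun_apply (fx y s) h)"
        by (intro blinfun_apply_integral integrable_continuous)
      also have "\<dots> = integral (cbox 0 1) (\<lambda>s. ?d H h (y, s))"
        using y by (intro integral_cong) (simp add: fx_apply)
      finally show ?thesis by simp
    qed
    ultimately show ?thesis
      using y \<open>open T\<close> by (simp add: at_within_open[of y T] has_derivative_eq_rhs fun_eq_iff)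
  qed
  have "Ck_on k T (?I H)" if "smooth_on N H" for k and H :: "'a \<times> real \<Rightarrow> 'b"
    using that
  proof (induction k arbitrary: H)
    case 0
    show ?case
      unfolding Ck_on.simps
      by (rule continuous_at_imp_continuous_on) (blast intro: has_derivative_continuous der[OF 0])
  next
    case (Suc k)
    have step: "Ck_on k T (\<lambda>y. ?I (?d H h) y)" for h
      by (rule Suc.IH[OF smooth_on_directional_derivative[OF Suc.prems]])
    show ?case
      by (rule Ck_on_derivI[OF \<open>open T\<close> der[OF Suc.prems] step])
  qed
  with assms(5) show ?thesis by (simp add: smooth_on_def)
qed

text \<open>
  Let \<open>A\<close> be the derivative of \<open>D\<close> at the zero \<open>z0\<close> and \<open>B\<close> a right inverse of \<open>A\<close>. The map
  \<open>\<Psi> z = z + B (D z - A (z - z0))\<close> has derivative the identity at \<open>z0\<close> and satisfies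
  \<open>A (\<Psi> z - z0) = D z\<close>, so in the coordinate \<open>y = \<Psi> z\<close> the map \<open>D\<close> becomes \<open>y \<mapsto> A (y - z0)\<close>. The
  projection \<open>y - P y\<close> with \<open>P y = B (A (y - z0))\<close> lands in the zero set, where \<open>f\<close> vanishes, and
  integrating the derivative of \<open>f\<close> along the segment from \<open>y - P y\<close> to \<open>y\<close>, whose direction
  \<open>P y\<close> is linear in \<open>A (y - z0)\<close>, exhibits the quotient.
\<close>

lemma division_by_submersion_local:
  fixes D :: "'a::euclidean_space \<Rightarrow> 'b::euclidean_space" and f :: "'a \<Rightarrow> real"
  assumes "open W" and D: "smooth_on W D" and f: "smooth_on W f"
    and zero: "\<And>z. z \<in> W \<Longrightarrow> D z = 0 \<Longrightarrow> f z = 0"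
    and z0: "z0 \<in> W" "D z0 = 0" and surj: "surj (frechet_derivative D (at z0))"
  shows "\<exists>T q. open T \<and> z0 \<in> T \<and> T \<subseteq> W \<and> smooth_on T q \<and> (\<forall>z\<in>T. f z = q z \<bullet> D z)"
proof -
  define A where "A = frechet_derivative D (at z0)"
  have linA: "linear A"
    unfolding A_def by (rule smooth_on_linear_derivative[OF D z0(1)])
  obtain B where linB: "linear B" and "A \<circ> B = id"
    using linear_surjective_right_inverse[OF linA] surj by (auto simp: A_def)
  then have AB: "A (B w) = w" for w by (metis comp_apply id_apply)
  have blA: "bounded_linear A" and blB: "bounded_linear B"
    using linA linB by (simp_all add: linear_conv_bounded_linear)
  define \<Psi> where "\<Psi> z = z + B (D z - A (z - z0))" for z
  have Psi: "smooth_on W \<Psi>"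
    unfolding \<Psi>_def using \<open>open W\<close> D
    by (intro smooth_on_add smooth_on_id smooth_on_linear_compose[OF _ blB] smooth_on_diff
        smooth_on_linear_compose[OF _ blA] smooth_on_const)
  have "(\<Psi> has_derivative (\<lambda>h. h)) (at z0)"
  proof -
    have "(D has_derivative A) (at z0)"
      unfolding A_def by (rule smooth_on_has_derivative[OF D z0(1)])
    then have "(\<Psi> has_derivative (\<lambda>h. h + B (A h - A (h - 0)))) (at z0)"
      unfolding \<Psi>_def
      by (intro has_derivative_add has_derivative_ident bounded_linear.has_derivative[OF blB]
          has_derivative_diff bounded_linear.has_derivative[OF blA] has_derivative_const)
    then show ?thesis using linear_0[OF linB] by simp
  qed
  then have "frechet_derivative \<Psi> (at z0) = (\<lambda>h. h)"
    using frechet_derivative_at by metis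
  then have "inj (frechet_derivative \<Psi> (at z0))" by simp
  then obtain U' V \<Theta> where U': "open U'" "U' \<subseteq> W" "z0 \<in> U'" and V: "open V" "\<Psi> z0 \<in> V"
    and hom: "homeomorphism U' V \<Psi> \<Theta>" and Theta: "smooth_on V \<Theta>"
    by (rule smooth_inverse_function[OF \<open>open W\<close> Psi z0(1)])
  have Theta_Psi: "\<Psi> z \<in> V" "\<Theta> (\<Psi> z) = z" if "z \<in> U'" for z
    using hom that by (auto simp: homeomorphism_def)
  have Psi_Theta: "\<Theta> y \<in> U'" "\<Psi> (\<Theta> y) = y" if "y \<in> V" for y
    using hom that by (auto simp: homeomorphism_def)
  have "\<Psi> z0 = z0"
    using z0(2) linA linB by (simp add: \<Psi>_def linear_0)
  have A_Psi: "A (\<Psi> z - z0) = D z" for z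
    by (simp add: \<Psi>_def linear_add[OF linA] linear_diff[OF linA] AB)
  have D_Theta: "D (\<Theta> y) = A (y - z0)" if "y \<in> V" for y
    using A_Psi[of "\<Theta> y"] Psi_Theta[OF that] by simp
  define F where "F y = f (\<Theta> y)" for y
  have F: "smooth_on V F"
    unfolding F_def using Psi_Theta U'(2)
    by (intro smooth_on_compose[OF V(1) \<open>open W\<close> f Theta]) auto
  define P where "P y = B (A (y - z0))" for y
  obtain r where "r > 0" and r: "ball z0 r \<subseteq> V"
    using V \<open>\<Psi> z0 = z0\<close> open_contains_ball by metis
  obtain C where "C > 0" and C: "\<And>x. norm (B (A x)) \<le> C * norm x"
    using linear_bounded_pos[OF linear_compose[OF linA linB]] by auto
  \<comment> \<open>The radius keeps the whole segment from \<open>y\<close> to \<open>y - P y\<close> inside \<open>ball z0 r\<close>.\<close>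
  define T where "T = ball z0 (r / (1 + C))"
  have z0T: "z0 \<in> T" and openT: "open T" and convT: "convex T"
    using \<open>r > 0\<close> \<open>C > 0\<close> by (auto simp: T_def)
  have seg: "y - s *\<^sub>R P y \<in> V" if "y \<in> T" "s \<in> {0..1}" for y s
  proof -
    have "norm (y - s *\<^sub>R P y - z0) \<le> norm (y - z0) + \<bar>s\<bar> * norm (P y)"
      using norm_triangle_ineq4[of "y - z0" "s *\<^sub>R P y"] by (simp add: algebra_simps)
    also have "\<dots> \<le> norm (y - z0) + 1 * (C * norm (y - z0))"
      using that C by (intro add_left_mono mult_mono) (auto simp: P_def)
    also have "\<dots> = (1 + C) * norm (y - z0)"
      by (simp add: algebra_simps)
    also have "\<dots> < r"
      using that(1) \<open>C > 0\<close> by (simp add: T_def dist_norm norm_minus_commute field_simps)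
    finally have "y - s *\<^sub>R P y \<in> ball z0 r"
      by (simp add: dist_norm norm_minus_commute)
    then show ?thesis using r by blast
  qed
  define q where "q y = (\<Sum>b\<in>Basis. integral {0..1} (\<lambda>s. frechet_derivative F (at (y - s *\<^sub>R P y)) (B b)) *\<^sub>R b)" for y
  have q: "smooth_on T q"
  proof -
    define N where "N = (\<lambda>(y, s). y - s *\<^sub>R P y) -` V"
    have blP: "smooth_on S P" if "open S" for S
      unfolding P_def using that
      by (intro smooth_on_linear_compose[OF _ blB] smooth_on_diff
          smooth_on_linear_compose[OF _ blA] smooth_on_const smooth_on_id)
    have arg: "smooth_on S (\<lambda>z. fst z - snd z *\<^sub>R P (fst z))" if "open S" for S :: "('a \<times> real) set"
      using that
      by (intro smooth_on_diff smooth_on_scaleR smooth_on_fst smooth_on_snd smooth_on_id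
          smooth_on_compose[OF _ open_UNIV blP]) auto
    have "open N"
      unfolding N_def case_prod_beta
      by (rule open_vimage[OF V(1) smooth_on_continuous_on[OF arg[OF open_UNIV]]])
    moreover have "smooth_on N (\<lambda>(y, s). frechet_derivative F (at (y - s *\<^sub>R P y)) w)" for w
      unfolding case_prod_beta
      by (rule smooth_on_compose[OF \<open>open N\<close> V(1) smooth_on_directional_derivative[OF F] arg[OF \<open>open N\<close>]])
         (auto simp: N_def)
    ultimately have "smooth_on T (\<lambda>y. integral {0..1} (\<lambda>s. (\<lambda>(y, s). frechet_derivative F (at (y - s *\<^sub>R P y)) w) (y, s)))" for w
      using seg by (intro smooth_on_integral[OF openT convT]) (auto simp: N_def)
    then show ?thesis
      unfolding q_def by (intro smooth_on_sum[OF openT] smooth_on_scaleR[OF openT] smooth_on_const) simp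
  qed
  have Fq: "F y = q y \<bullet> A (y - z0)" if y: "y \<in> T" for y
  proof -
    let ?G = "\<lambda>s. frechet_derivative F (at (y - s *\<^sub>R P y))"
    have lin: "linear (?G s)" if "s \<in> {0..1}" for s
      by (rule smooth_on_linear_derivative[OF F seg[OF y that]])
    have "((\<lambda>s. F (y - s *\<^sub>R P y)) has_vector_derivative - ?G s (P y)) (at s within {0..1})"
      if s: "s \<in> {0..1}" for s
    proof -
      have "((\<lambda>s. y - s *\<^sub>R P y) has_derivative (\<lambda>t. - t *\<^sub>R P y)) (at s)"
        by (auto intro!: derivative_eq_intros)
      then have "((\<lambda>s. F (y - s *\<^sub>R P y)) has_derivative (\<lambda>t. ?G s (- t *\<^sub>R P y))) (at s)"
        by (rule has_derivative_compose[where g = F and f = "\<lambda>s. y - s *\<^sub>R P y",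
            OF _ smooth_on_has_derivative[OF F seg[OF y s]]])
      moreover have "?G s (- t *\<^sub>R P y) = t *\<^sub>R - ?G s (P y)" for t
        by (simp only: linear_scale[OF lin[OF s]]) simp
      ultimately show ?thesis
        unfolding has_vector_derivative_def by (simp only: has_derivative_at_withinI)
    qed
    then have "((\<lambda>s. - ?G s (P y)) has_integral F (y - 1 *\<^sub>R P y) - F (y - 0 *\<^sub>R P y)) {0..1}"
      by (intro fundamental_theorem_of_calculus) auto
    moreover have "F (y - P y) = 0"
    proof -
      have yP: "y - P y \<in> V" using seg[OF y, of 1] by simp
      have "y - P y - z0 = (y - z0) - P y" by simp
      then have "A (y - P y - z0) = A (y - z0) - A (P y)"
        by (simp only: linear_diff[OF linA])
      then have "D (\<Theta> (y - P y)) = 0"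
        using D_Theta[OF yP] by (simp add: P_def AB)
      then show ?thesis
        using zero Psi_Theta(1)[OF yP] U'(2) by (auto simp: F_def)
    qed
    ultimately have "((\<lambda>s. - ?G s (P y)) has_integral - F y) {0..1}" by simp
    then have 1: "((\<lambda>s. ?G s (P y)) has_integral F y) {0..1}"
      using has_integral_neg[of "\<lambda>s. - ?G s (P y)" "- F y" "{0..1}"] by simp
    have cont: "continuous_on {0..1} (\<lambda>s. ?G s w)" for w
      by (rule continuous_on_compose2[OF smooth_on_continuous_on[OF smooth_on_directional_derivative[OF F]]])
         (use seg[OF y] in \<open>auto intro!: continuous_intros\<close>)
    have "((\<lambda>s. \<Sum>b\<in>Basis. (A (y - z0) \<bullet> b) * ?G s (B b)) has_integral
        (\<Sum>b\<in>Basis. (A (y - z0) \<bullet> b) * integral {0..1} (\<lambda>s. ?G s (B b)))) {0..1}"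
      using cont by (intro has_integral_sum has_integral_mult_right integrable_integral
          integrable_continuous_interval) auto
    moreover have "(\<Sum>b\<in>Basis. (A (y - z0) \<bullet> b) * ?G s (B b)) = ?G s (P y)" if "s \<in> {0..1}" for s
    proof -
      have "P y = B (\<Sum>b\<in>Basis. (A (y - z0) \<bullet> b) *\<^sub>R b)"
        unfolding P_def euclidean_representation ..
      also have "\<dots> = (\<Sum>b\<in>Basis. (A (y - z0) \<bullet> b) *\<^sub>R B b)"
        by (simp add: linear_sum[OF linB] linear_scale[OF linB])
      finally have "?G s (P y) = ?G s (\<Sum>b\<in>Basis. (A (y - z0) \<bullet> b) *\<^sub>R B b)"
        by (rule arg_cong)
      then show ?thesis
        by (simp only: linear_sum[OF lin[OF that]] linear_scale[OF lin[OF that]] real_scaleR_def)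
    qed
    ultimately have "((\<lambda>s. ?G s (P y)) has_integral
        (\<Sum>b\<in>Basis. (A (y - z0) \<bullet> b) * integral {0..1} (\<lambda>s. ?G s (B b)))) {0..1}"
      by (rule has_integral_eq[rotated])
    with 1 have "F y = (\<Sum>b\<in>Basis. (A (y - z0) \<bullet> b) * integral {0..1} (\<lambda>s. ?G s (B b)))"
      by (rule has_integral_unique)
    then show ?thesis
      by (simp add: q_def inner_sum_right mult.commute inner_commute[of _ "A (y - z0)"])
  qed
  define T' where "T' = U' \<inter> \<Psi> -` T"
  have "open T'"
    unfolding T'_def
    using continuous_on_open_vimage[OF U'(1)] smooth_on_continuous_on[OF smooth_on_subset[OF Psi U'(2)]] openT
    by (metis Int_commute)
  moreover have "z0 \<in> T'" using U' z0T \<open>\<Psi> z0 = z0\<close> by (simp add: T'_def)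
  moreover have "T' \<subseteq> W" using U' by (auto simp: T'_def)
  moreover have "smooth_on T' (\<lambda>z. q (\<Psi> z))"
    using \<open>T' \<subseteq> W\<close> by (intro smooth_on_compose[OF \<open>open T'\<close> openT q smooth_on_subset[OF Psi]]) (auto simp: T'_def)
  moreover have "\<forall>z\<in>T'. f z = q (\<Psi> z) \<bullet> D z"
  proof
    fix z assume "z \<in> T'"
    then have "F (\<Psi> z) = q (\<Psi> z) \<bullet> D z" "f z = F (\<Psi> z)"
      using Fq[of "\<Psi> z"] Theta_Psi(2)[of z] A_Psi[of z] by (auto simp: T'_def F_def)
    then show "f z = q (\<Psi> z) \<bullet> D z" by simp
  qed
  ultimately show ?thesis
    by (intro exI[of _ T'] exI[of _ "\<lambda>z. q (\<Psi> z)"]) blast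
qed

section \<open>Gluing local quotients\<close>

text \<open>
  The factor \<open>x\<^sup>-\<^sup>m\<close> makes the family closed under differentiation up to linear combinations, so
  all members are shown to be smooth by one simultaneous induction.
\<close>

definition flat :: "nat \<Rightarrow> real \<Rightarrow> real" where
  "flat m x = (if x \<le> 0 then 0 else inverse x ^ m * exp (- inverse x))"

lemma flat_has_derivative:
  "(flat m has_derivative (\<lambda>v. v * (flat (m + 2) x - real m * flat (m + 1) x))) (at x)"
proof -
  consider "x < 0" | "x = 0" | "x > 0" by linarith
  then have "(flat m has_real_derivative (flat (m + 2) x - real m * flat (m + 1) x)) (at x)"
  proof cases
    case 1
    have "(flat m has_real_derivative 0) (at x)"
      by (rule has_field_derivative_transform_within_open[OF DERIV_const, where S = "{..<0}"])
         (use 1 in \<open>auto simp: flat_def\<close>)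
    then show ?thesis using 1 by (simp add: flat_def)
  next
    case 3
    have "((\<lambda>x. inverse x ^ m * exp (- inverse x)) has_real_derivative
        flat (m + 2) x - real m * flat (m + 1) x) (at x)"
      using 3
      by (auto intro!: derivative_eq_intros simp: flat_def field_simps power2_eq_square)
         (cases m; simp add: field_simps)
    then show ?thesis
      by (rule has_field_derivative_transform_within_open[where S = "{0<..}"])
         (use 3 in \<open>auto simp: flat_def\<close>)
  next
    case 2
    have "((\<lambda>h. inverse h ^ (m + 1) / exp (inverse h)) \<longlongrightarrow> 0) (at_right (0::real))"
      by (rule filterlim_compose[OF tendsto_power_div_exp_0 filterlim_inverse_at_top_right])
    then have "((\<lambda>h. flat m h / h) \<longlongrightarrow> 0) (at_right 0)"
      by (rule tendsto_cong[THEN iffD1, rotated])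
         (auto simp: eventually_at_right_field flat_def exp_minus field_simps intro!: exI[of _ 1])
    moreover have "((\<lambda>h. flat m h / h) \<longlongrightarrow> 0) (at_left 0)"
      by (rule tendsto_eventually) (auto simp: eventually_at_left_field flat_def intro!: exI[of _ "-1"])
    ultimately have "((\<lambda>h. flat m h / h) \<longlongrightarrow> 0) (at 0)"
      by (simp add: filterlim_split_at)
    moreover have "flat k 0 = 0" for k by (simp add: flat_def)
    ultimately show ?thesis
      using 2 by (simp add: DERIV_def)
  qed
  then show ?thesis
    unfolding has_field_derivative_def mult.commute[of _ "flat (m + 2) x - real m * flat (m + 1) x"] .
qed

lemma smooth_flat: "smooth_on UNIV (flat 0)"
proof -
  have "Ck_on k UNIV (flat m)" for k m
  proof (induction k arbitrary: m)
    case 0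
    show ?case
      unfolding Ck_on.simps
      by (rule continuous_at_imp_continuous_on) (blast intro: has_derivative_continuous flat_has_derivative)
  next
    case (Suc k)
    have "Ck_on k UNIV (\<lambda>x. v * (flat (m + 2) x + (- real m) * flat (m + 1) x))" for v
      by (intro Ck_on_bilinear[OF open_UNIV bounded_bilinear_mult] Ck_on_add[OF open_UNIV]
          Ck_on_const Suc.IH)
    then have step: "Ck_on k UNIV (\<lambda>x. v * (flat (m + 2) x - real m * flat (m + 1) x))" for v
      by simp
    show ?case
      by (rule Ck_on_derivI[OF open_UNIV flat_has_derivative step])
  qed
  then show ?thesis by (simp add: smooth_on_def)
qed

lemma smooth_bump:
  fixes a :: "'a::euclidean_space"
  assumes "0 < r" "r < R"
  obtains \<phi> :: "'a \<Rightarrow> real" where "smooth_on UNIV \<phi>"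
    "\<And>x. dist a x \<le> r \<Longrightarrow> \<phi> x = 1" "\<And>x. R \<le> dist a x \<Longrightarrow> \<phi> x = 0"
proof -
  define e where "e = flat 0"
  define s where "s x = (x - a) \<bullet> (x - a)" for x
  define \<phi> where "\<phi> x = e (R\<^sup>2 - s x) / (e (R\<^sup>2 - s x) + e (s x - r\<^sup>2))" for x
  have e: "smooth_on UNIV e"
    using smooth_flat by (simp add: e_def)
  have e_nonneg: "e t \<ge> 0" and e_pos: "t > 0 \<Longrightarrow> e t > 0" for t by (simp_all add: e_def flat_def)
  have "r\<^sup>2 < R\<^sup>2" using assms by (intro power_strict_mono) auto
  then have pos: "e (R\<^sup>2 - t) + e (t - r\<^sup>2) \<noteq> 0" for t
    using e_pos[of "R\<^sup>2 - t"] e_nonneg[of "R\<^sup>2 - t"] e_pos[of "t - r\<^sup>2"] e_nonneg[of "t - r\<^sup>2"]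
    by (cases "t < R\<^sup>2") (auto simp: add_nonneg_pos add_pos_nonneg less_imp_neq[symmetric])
  have s: "smooth_on UNIV s"
    unfolding s_def by (intro smooth_on_inner smooth_on_diff smooth_on_const smooth_on_id open_UNIV)
  have "smooth_on UNIV \<phi>"
    unfolding \<phi>_def using pos
    by (intro smooth_on_divide smooth_on_add smooth_on_compose[OF _ _ e] smooth_on_diff s
        smooth_on_const open_UNIV) auto
  moreover have s_dist: "s x = (dist a x)\<^sup>2" for x
    by (simp add: s_def dist_norm norm_minus_commute[of a x] power2_norm_eq_inner)
  moreover have "\<phi> x = 1" if "dist a x \<le> r" for x
  proof -
    have "s x \<le> r\<^sup>2" using that by (simp add: s_dist power_mono)
    then have "e (s x - r\<^sup>2) = 0" by (simp add: e_def flat_def)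
    then show ?thesis using pos[of "s x"] by (simp add: \<phi>_def)
  qed
  moreover have "\<phi> x = 0" if "R \<le> dist a x" for x
  proof -
    have "R\<^sup>2 \<le> s x" using that assms by (simp add: s_dist power_mono)
    then show ?thesis by (simp add: \<phi>_def e_def flat_def)
  qed
  ultimately show ?thesis using that by blast
qed

text \<open>
  Countably many balls \<open>?B (a k)\<close> cover \<open>W\<close>; let \<open>\<phi> k\<close> be a bump function equal to \<open>1\<close> on the \<open>k\<close>-th
  ball and supported where the \<open>k\<close>-th local quotient lives. The weights \<open>\<phi> k * P k\<close> with
  \<open>P k = (\<Prod>j<k. 1 - \<phi> j)\<close> telescope: their sum over \<open>i < k\<close> is \<open>1 - P k\<close>. As \<open>P k\<close> vanishes on the \<open>j\<close>-th
  ball for \<open>k > j\<close>, the weighted sum of the quotients is finite there and needs no normalisation.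
\<close>

lemma smooth_quotient_gluing:
  fixes D :: "'a::euclidean_space \<Rightarrow> 'b::euclidean_space" and f :: "'a \<Rightarrow> real"
  assumes "open W"
    and local: "\<And>z. z \<in> W \<Longrightarrow>
      \<exists>T q. open T \<and> z \<in> T \<and> T \<subseteq> W \<and> smooth_on T q \<and> (\<forall>y\<in>T. f y = q y \<bullet> D y)"
  shows "\<exists>q. smooth_on W q \<and> (\<forall>z\<in>W. f z = q z \<bullet> D z)"
proof (cases "W = {}")
  case True
  then show ?thesis using smooth_on_const[of "{}" "0 :: 'b"] by blast
next
  case False
  have "\<exists>\<rho> q T. 0 < \<rho> \<and> open T \<and> cball z \<rho> \<subseteq> T \<and> T \<subseteq> W \<and> smooth_on T q \<and> (\<forall>y\<in>T. f y = q y \<bullet> D y)"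
    if "z \<in> W" for z
    using local[OF that] open_contains_cball by metis
  then have "\<exists>\<rho> q T. \<forall>z\<in>W. 0 < \<rho> z \<and> open (T z) \<and> cball z (\<rho> z) \<subseteq> T z \<and> T z \<subseteq> W
      \<and> smooth_on (T z) (q z) \<and> (\<forall>y\<in>T z. f y = q z y \<bullet> D y)"
    by metis
  then obtain \<rho> q T where \<rho>: "\<And>z. z \<in> W \<Longrightarrow> 0 < \<rho> z"
    and T: "\<And>z. z \<in> W \<Longrightarrow> open (T z)" "\<And>z. z \<in> W \<Longrightarrow> cball z (\<rho> z) \<subseteq> T z" "\<And>z. z \<in> W \<Longrightarrow> T z \<subseteq> W"
    and q: "\<And>z. z \<in> W \<Longrightarrow> smooth_on (T z) (q z)" "\<And>z y. z \<in> W \<Longrightarrow> y \<in> T z \<Longrightarrow> f y = q z y \<bullet> D y"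
    by blast
  let ?B = "\<lambda>z. ball z (\<rho> z / 2)"
  obtain \<F> where \<F>: "\<F> \<subseteq> ?B ` W" "countable \<F>" and cover: "\<Union>\<F> = \<Union>(?B ` W)"
    by (rule Lindelof[of "?B ` W"]) auto
  then obtain C where C: "C \<subseteq> W" "countable C" "\<F> = ?B ` C"
    using countable_subset_image[of \<F> ?B W] by auto
  have W_cover: "z \<in> \<Union>(?B ` C)" if "z \<in> W" for z
  proof -
    have "z \<in> ?B z" using \<rho>[OF that] by simp
    then have "z \<in> \<Union>(?B ` W)" using that by blast
    then show ?thesis unfolding cover[symmetric] C(3) .
  qed
  then have "C \<noteq> {}" using False by blast
  define a where "a = from_nat_into C"
  have range_a: "range a = C" unfolding a_def using \<open>C \<noteq> {}\<close> C(2) by (rule range_from_nat_into)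
  then have aW: "a k \<in> W" for k using C(1) by auto
  have covered: "\<exists>k. z \<in> ?B (a k)" if "z \<in> W" for z
    using W_cover[OF that] unfolding range_a[symmetric] by auto
  have "\<exists>\<phi> :: 'a \<Rightarrow> real. smooth_on UNIV \<phi> \<and> (\<forall>x. dist (a k) x \<le> \<rho> (a k) / 2 \<longrightarrow> \<phi> x = 1)
      \<and> (\<forall>x. \<rho> (a k) \<le> dist (a k) x \<longrightarrow> \<phi> x = 0)" for k
    using smooth_bump[of "\<rho> (a k) / 2" "\<rho> (a k)" "a k"] \<rho>[OF aW[of k]] by (metis half_gt_zero field_sum_of_halves less_add_same_cancel1)
  then obtain \<phi> :: "nat \<Rightarrow> 'a \<Rightarrow> real" where \<phi>: "\<And>k. smooth_on UNIV (\<phi> k)"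
    and \<phi>1: "\<And>k x. dist (a k) x \<le> \<rho> (a k) / 2 \<Longrightarrow> \<phi> k x = 1"
    and \<phi>0: "\<And>k x. \<rho> (a k) \<le> dist (a k) x \<Longrightarrow> \<phi> k x = 0"
    by metis
  define p where "p k z = (if z \<in> T (a k) then \<phi> k z *\<^sub>R q (a k) z else 0)" for k z
  define P where "P k z = (\<Prod>j<k. 1 - \<phi> j z)" for k z
  define G where "G k z = (\<Sum>i<k. P i z *\<^sub>R p i z)" for k z
  have p: "smooth_on W (p k)" for k
  proof (rule smooth_on_local)
    fix z assume "z \<in> W"
    show "\<exists>S. open S \<and> z \<in> S \<and> smooth_on S (p k)"
    proof (cases "z \<in> T (a k)")
      case True
      have "smooth_on (T (a k)) (\<lambda>z. \<phi> k z *\<^sub>R q (a k) z)"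
        by (intro smooth_on_scaleR T(1) q(1) aW smooth_on_subset[OF \<phi>]) auto
      then have "smooth_on (T (a k)) (p k)"
        by (rule smooth_on_cong[OF T(1)[OF aW], rotated]) (simp add: p_def)
      then show ?thesis using True T(1)[OF aW] by blast
    next
      case False
      let ?S = "- cball (a k) (\<rho> (a k))"
      have "smooth_on ?S (p k)"
        by (rule smooth_on_cong[OF _ _ smooth_on_const[of _ 0]])
           (auto simp: p_def \<phi>0 open_Compl)
      moreover have "z \<in> ?S" using False T(2)[OF aW] by blast
      ultimately show ?thesis by (intro exI[of _ ?S]) (simp add: open_Compl)
    qed
  qed
  have P: "smooth_on W (P k)" for k
  proof (induction k)
    case 0
    then show ?case by (simp add: P_def)
  next
    case (Suc k)
    have "smooth_on W (\<lambda>z. P k z * (1 - \<phi> k z))"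
      by (intro smooth_on_mult smooth_on_diff smooth_on_const \<open>open W\<close> Suc.IH smooth_on_subset[OF \<phi>]) auto
    then show ?case by (simp add: P_def)
  qed
  have G: "smooth_on W (G k)" for k
    unfolding G_def by (intro smooth_on_sum smooth_on_scaleR p P \<open>open W\<close>)
  have pD: "p k z \<bullet> D z = \<phi> k z * f z" for k z
  proof (cases "z \<in> T (a k)")
    case True
    then show ?thesis using q(2)[OF aW True] by (simp add: p_def)
  next
    case False
    then have "z \<notin> cball (a k) (\<rho> (a k))" using T(2)[OF aW] by blast
    then show ?thesis using False \<phi>0 by (simp add: p_def)
  qed
  have GD: "G k z \<bullet> D z = (1 - P k z) * f z" for k z
    by (induction k) (simp_all add: G_def P_def inner_add_left pD algebra_simps)
  have P0: "P k z = 0" if "z \<in> ?B (a j)" "j < k" for j k z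
    using that \<phi>1[of j z] by (auto simp: P_def intro!: bexI[of _ j])
  have stable: "G k z = G (Suc j) z" if "z \<in> ?B (a j)" "Suc j \<le> k" for j k z
    using that(2)
  proof (induction k rule: dec_induct)
    case (step n)
    then show ?case using P0[OF that(1), of n] by (simp add: G_def)
  qed simp
  \<comment> \<open>On the \<open>j\<close>-th ball the sums \<open>G k\<close> are constant for \<open>k > j\<close>, so any index of a ball containing \<open>z\<close> gives the same value.\<close>
  define N where "N z = (LEAST j. z \<in> ?B (a j))" for z
  define Q where "Q z = G (Suc (N z)) z" for z
  have Q: "Q z = G (Suc j) z" if "z \<in> ?B (a j)" for j z
    using stable[of z "N z" "Suc j"] LeastI[of "\<lambda>j. z \<in> ?B (a j)", OF that]
      Least_le[of "\<lambda>j. z \<in> ?B (a j)", OF that] by (simp add: Q_def N_def)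
  have "smooth_on W Q"
  proof (rule smooth_on_local)
    fix z assume "z \<in> W"
    then obtain j where j: "z \<in> ?B (a j)" using covered by blast
    have "smooth_on (W \<inter> ?B (a j)) Q"
      by (rule smooth_on_cong[OF _ _ smooth_on_subset[OF G[of "Suc j"]]])
         (use \<open>open W\<close> Q in auto)
    then show "\<exists>S. open S \<and> z \<in> S \<and> smooth_on S Q"
      using \<open>z \<in> W\<close> j \<open>open W\<close> by (intro exI[of _ "W \<inter> ?B (a j)"]) auto
  qed
  moreover have "f z = Q z \<bullet> D z" if "z \<in> W" for z
  proof -
    obtain j where j: "z \<in> ?B (a j)" using covered[OF \<open>z \<in> W\<close>] by blast
    then show ?thesis using GD[of "Suc j" z] P0[OF j, of "Suc j"] Q[OF j] by simp
  qed
  ultimately show ?thesis by blast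
qed

theorem division_by_submersion:
  fixes D :: "'a::euclidean_space \<Rightarrow> 'b::euclidean_space" and f :: "'a \<Rightarrow> real"
  assumes "open W" and D: "smooth_on W D" and f: "smooth_on W f"
    and zero: "\<And>z. z \<in> W \<Longrightarrow> D z = 0 \<Longrightarrow> f z = 0"
    and surj: "\<And>z. z \<in> W \<Longrightarrow> D z = 0 \<Longrightarrow> surj (frechet_derivative D (at z))"
  shows "\<exists>q. smooth_on W q \<and> (\<forall>z\<in>W. f z = q z \<bullet> D z)"
proof (rule smooth_quotient_gluing[OF \<open>open W\<close>])
  fix z assume z: "z \<in> W"
  show "\<exists>T q. open T \<and> z \<in> T \<and> T \<subseteq> W \<and> smooth_on T q \<and> (\<forall>y\<in>T. f y = q y \<bullet> D y)"
  proof (cases "D z = 0")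
    case True
    then show ?thesis
      using division_by_submersion_local[OF \<open>open W\<close> D f zero z True surj[OF z True]] by blast
  next
    case False
    let ?T = "W \<inter> D -` (- {0})"
    have "open ?T"
      using continuous_on_open_vimage[OF \<open>open W\<close>] smooth_on_continuous_on[OF D]
      by (metis Int_commute open_Compl closed_singleton)
    moreover have "smooth_on ?T (\<lambda>y. (f y / (D y \<bullet> D y)) *\<^sub>R D y)"
      using \<open>open ?T\<close>
      by (intro smooth_on_scaleR smooth_on_divide smooth_on_inner smooth_on_subset[OF D]
          smooth_on_subset[OF f]) auto
    moreover have "\<forall>y\<in>?T. f y = ((f y / (D y \<bullet> D y)) *\<^sub>R D y) \<bullet> D y"
      by simp
    ultimately show ?thesis
      using z False
      by (intro exI[of _ ?T] exI[of _ "\<lambda>y. (f y / (D y \<bullet> D y)) *\<^sub>R D y"]) blast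
  qed
qed

section \<open>Partial derivatives of smooth maps\<close>

lemma has_real_derivative_along_line:
  assumes "smooth_on S f" "a + t *\<^sub>R v \<in> S"
  shows "((\<lambda>t. f (a + t *\<^sub>R v)) has_real_derivative frechet_derivative f (at (a + t *\<^sub>R v)) v) (at t)"
proof -
  have "((\<lambda>t. a + t *\<^sub>R v) has_derivative (\<lambda>s. s *\<^sub>R v)) (at t)"
    by (auto intro!: derivative_eq_intros)
  then have "((\<lambda>t. f (a + t *\<^sub>R v)) has_derivative (\<lambda>s. frechet_derivative f (at (a + t *\<^sub>R v)) (s *\<^sub>R v))) (at t)"
    by (rule has_derivative_compose[where f = "\<lambda>t. a + t *\<^sub>R v" and g = f, OF _ smooth_on_has_derivative[OF assms]])
  then show ?thesis
    unfolding has_field_derivative_def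
    by (simp only: linear_scale[OF smooth_on_linear_derivative[OF assms]] real_scaleR_def
        mult.commute[of _ "frechet_derivative f (at (a + t *\<^sub>R v)) v"])
qed

lemma mean_value_along_line:
  fixes f :: "'a::real_normed_vector \<Rightarrow> real"
  assumes "smooth_on S f" "0 < h" "\<And>t. 0 \<le> t \<Longrightarrow> t \<le> h \<Longrightarrow> a + t *\<^sub>R v \<in> S"
  obtains t where "0 < t" "t < h"
    "f (a + h *\<^sub>R v) - f a = h * frechet_derivative f (at (a + t *\<^sub>R v)) v"
  using MVT2[OF \<open>0 < h\<close> has_real_derivative_along_line[OF assms(1,3)]] by auto

text \<open>
  Two applications of the mean value theorem; the left-hand side is symmetric in \<open>v\<close> and \<open>w\<close>, which
  is why mixed derivatives agree in the limit \<open>h \<rightarrow> 0\<close>.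
\<close>

lemma second_difference:
  fixes f :: "'a::euclidean_space \<Rightarrow> real"
  assumes "open S" "smooth_on S f" "0 < h"
    and S: "\<And>s t. 0 \<le> s \<Longrightarrow> s \<le> h \<Longrightarrow> 0 \<le> t \<Longrightarrow> t \<le> h \<Longrightarrow> x + s *\<^sub>R v + t *\<^sub>R w \<in> S"
  obtains s t where "0 < s" "s < h" "0 < t" "t < h"
    "f (x + h *\<^sub>R v + h *\<^sub>R w) - f (x + h *\<^sub>R v) - f (x + h *\<^sub>R w) + f x
      = h * h * frechet_derivative (\<lambda>y. frechet_derivative f (at y) v) (at (x + s *\<^sub>R v + t *\<^sub>R w)) w"
proof -
  let ?S = "S \<inter> (\<lambda>y. y + h *\<^sub>R w) -` S"
  let ?\<phi> = "\<lambda>y. f (y + h *\<^sub>R w) - f y"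
  have S2: "open ?S"
    by (intro open_Int \<open>open S\<close> open_vimage continuous_intros)
  have "smooth_on ?S ?\<phi>"
    by (intro smooth_on_diff S2 smooth_on_compose[OF S2 \<open>open S\<close> assms(2)] smooth_on_add
        smooth_on_id smooth_on_const smooth_on_subset[OF assms(2)]) auto
  moreover have "x + t *\<^sub>R v \<in> ?S" if "0 \<le> t" "t \<le> h" for t
    using S[OF that, of 0] S[OF that, of h] \<open>0 < h\<close> by auto
  ultimately obtain s where s: "0 < s" "s < h"
    and eq1: "?\<phi> (x + h *\<^sub>R v) - ?\<phi> x = h * frechet_derivative ?\<phi> (at (x + s *\<^sub>R v)) v"
    by (rule mean_value_along_line[OF _ \<open>0 < h\<close>])
  have xs: "x + s *\<^sub>R v \<in> S" "x + s *\<^sub>R v + h *\<^sub>R w \<in> S"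
    using S[of s 0] S[of s h] s \<open>0 < h\<close> by auto
  have "((\<lambda>y. y + h *\<^sub>R w) has_derivative (\<lambda>v. v)) (at (x + s *\<^sub>R v))"
    by (auto intro!: derivative_eq_intros)
  then have "((\<lambda>y. f (y + h *\<^sub>R w)) has_derivative
      frechet_derivative f (at (x + s *\<^sub>R v + h *\<^sub>R w))) (at (x + s *\<^sub>R v))"
    by (rule has_derivative_compose[where f = "\<lambda>y. y + h *\<^sub>R w" and g = f,
          OF _ smooth_on_has_derivative[OF assms(2) xs(2)]])
  then have \<phi>': "(?\<phi> has_derivative (\<lambda>k. frechet_derivative f (at (x + s *\<^sub>R v + h *\<^sub>R w)) k
      - frechet_derivative f (at (x + s *\<^sub>R v)) k)) (at (x + s *\<^sub>R v))"
    by (rule has_derivative_diff[OF _ smooth_on_has_derivative[OF assms(2) xs(1)]])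
  then have eq2: "frechet_derivative ?\<phi> (at (x + s *\<^sub>R v)) v
      = frechet_derivative f (at (x + s *\<^sub>R v + h *\<^sub>R w)) v - frechet_derivative f (at (x + s *\<^sub>R v)) v"
    by (simp only: frechet_derivative_at[OF \<phi>', symmetric])
  obtain t where t: "0 < t" "t < h"
    and eq3: "frechet_derivative f (at (x + s *\<^sub>R v + h *\<^sub>R w)) v - frechet_derivative f (at (x + s *\<^sub>R v)) v
      = h * frechet_derivative (\<lambda>y. frechet_derivative f (at y) v) (at (x + s *\<^sub>R v + t *\<^sub>R w)) w"
    by (rule mean_value_along_line[OF smooth_on_directional_derivative[OF assms(2)] \<open>0 < h\<close>,
          of "x + s *\<^sub>R v" w v]) (use S s in auto)
  show ?thesis
    using that[OF s t] eq1 unfolding eq2 eq3 by simp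
qed

lemma mixed_derivatives_commute_real:
  fixes f :: "'a::euclidean_space \<Rightarrow> real"
  assumes "open S" "smooth_on S f" "x \<in> S"
  shows "frechet_derivative (\<lambda>y. frechet_derivative f (at y) v) (at x) w
    = frechet_derivative (\<lambda>y. frechet_derivative f (at y) w) (at x) v"
proof -
  let ?D = "\<lambda>v w y. frechet_derivative (\<lambda>y. frechet_derivative f (at y) v) (at y) w"
  have cont: "continuous_on S (?D v w)" for v w
    by (intro smooth_on_continuous_on smooth_on_directional_derivative assms)
  have "dist (?D v w x) (?D w v x) < \<epsilon>" if "\<epsilon> > 0" for \<epsilon>
  proof -
    have "\<exists>\<delta>>0. \<forall>y\<in>S. dist y x < \<delta> \<longrightarrow> dist (?D v w y) (?D v w x) < \<epsilon> / 2" for v w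
      using cont[of v w] \<open>x \<in> S\<close> that unfolding continuous_on_iff by (metis half_gt_zero)
    then obtain d1 d2 where d: "d1 > 0" "d2 > 0"
      and d1: "\<And>y. y \<in> S \<Longrightarrow> dist y x < d1 \<Longrightarrow> dist (?D v w y) (?D v w x) < \<epsilon> / 2"
      and d2: "\<And>y. y \<in> S \<Longrightarrow> dist y x < d2 \<Longrightarrow> dist (?D w v y) (?D w v x) < \<epsilon> / 2"
      by metis
    obtain d3 where d3: "d3 > 0" "ball x d3 \<subseteq> S"
      using assms(1,3) open_contains_ball by blast
    define d where "d = min d1 (min d2 d3)"
    have "d > 0" using d d3 by (simp add: d_def)
    \<comment> \<open>The parallelogram with sides \<open>h v\<close> and \<open>h w\<close> lies in the ball of radius \<open>d\<close> around \<open>x\<close>.\<close>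
    define h where "h = d / (norm v + norm w + 1)"
    have npos: "norm v + norm w + 1 > 0" by (simp add: add_nonneg_pos)
    then have "h > 0" using \<open>d > 0\<close> by (simp add: h_def)
    have near: "dist (x + s *\<^sub>R v + t *\<^sub>R w) x < d" if "0 \<le> s" "s \<le> h" "0 \<le> t" "t \<le> h" for s t
    proof -
      have "dist (x + s *\<^sub>R v + t *\<^sub>R w) x \<le> s * norm v + t * norm w"
        using norm_triangle_ineq[of "s *\<^sub>R v" "t *\<^sub>R w"] that by (simp add: dist_norm add.assoc)
      also have "\<dots> \<le> h * norm v + h * norm w"
        using that by (intro add_mono mult_right_mono) auto
      also have "\<dots> < h * (norm v + norm w + 1)"
        using \<open>h > 0\<close> by (simp add: algebra_simps)
      also have "\<dots> = d" using npos by (simp add: h_def)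
      finally show ?thesis .
    qed
    have inS: "x + s *\<^sub>R v + t *\<^sub>R w \<in> S" if "0 \<le> s" "s \<le> h" "0 \<le> t" "t \<le> h" for s t
      using near[OF that] d3(2) by (auto simp: d_def dist_commute)
    have swap: "x + t *\<^sub>R w + s *\<^sub>R v = x + s *\<^sub>R v + t *\<^sub>R w" for s t
      by simp
    obtain s t where st: "0 < s" "s < h" "0 < t" "t < h" and
      e1: "f (x + h *\<^sub>R v + h *\<^sub>R w) - f (x + h *\<^sub>R v) - f (x + h *\<^sub>R w) + f x
        = h * h * ?D v w (x + s *\<^sub>R v + t *\<^sub>R w)"
      using second_difference[OF assms(1,2) \<open>h > 0\<close> inS] by blast
    have inS': "x + s *\<^sub>R w + t *\<^sub>R v \<in> S" if "0 \<le> s" "s \<le> h" "0 \<le> t" "t \<le> h" for s t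
      using inS[OF that(3,4,1,2)] by (simp only: swap)
    obtain s' t' where st': "0 < s'" "s' < h" "0 < t'" "t' < h" and
      e2: "f (x + h *\<^sub>R w + h *\<^sub>R v) - f (x + h *\<^sub>R w) - f (x + h *\<^sub>R v) + f x
        = h * h * ?D w v (x + s' *\<^sub>R w + t' *\<^sub>R v)"
      using second_difference[OF assms(1,2) \<open>h > 0\<close> inS'] by blast
    have "h * h * ?D v w (x + s *\<^sub>R v + t *\<^sub>R w) = h * h * ?D w v (x + s' *\<^sub>R w + t' *\<^sub>R v)"
      using e1 e2 by (simp only: swap[of h h])
    then have "?D v w (x + s *\<^sub>R v + t *\<^sub>R w) = ?D w v (x + t' *\<^sub>R v + s' *\<^sub>R w)"
      using \<open>h > 0\<close> by (simp add: swap)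
    moreover have "dist (?D v w (x + s *\<^sub>R v + t *\<^sub>R w)) (?D v w x) < \<epsilon> / 2"
      using near[of s t] inS[of s t] st by (intro d1) (auto simp: d_def)
    moreover have "dist (?D w v (x + t' *\<^sub>R v + s' *\<^sub>R w)) (?D w v x) < \<epsilon> / 2"
      using near[of t' s'] inS[of t' s'] st' by (intro d2) (auto simp: d_def)
    ultimately show ?thesis
      by (metis dist_triangle_half_r)
  qed
  then show ?thesis by (metis dist_pos_lt less_irrefl)
qed

lemma frechet_derivative_bounded_linear_compose:
  assumes "bounded_linear L" "smooth_on S f" "x \<in> S"
  shows "frechet_derivative (\<lambda>y. L (f y)) (at x) v = L (frechet_derivative f (at x) v)"
  by (simp only: frechet_derivative_at[OF bounded_linear.has_derivative[OF assms(1)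
        smooth_on_has_derivative[OF assms(2,3)]], symmetric])

lemma frechet_derivative_cong_open:
  assumes "open S" "x \<in> S" "\<And>y. y \<in> S \<Longrightarrow> f y = g y" "(f has_derivative f') (at x)"
  shows "frechet_derivative g (at x) = frechet_derivative f (at x)"
proof -
  have "(g has_derivative f') (at x)"
    by (rule has_derivative_transform_within_open[OF assms(4,1,2,3)])
  then show ?thesis
    using frechet_derivative_at[OF assms(4)] frechet_derivative_at[of g f' x] by simp
qed

lemma mixed_derivatives_commute:
  fixes f :: "'a::euclidean_space \<Rightarrow> 'b::euclidean_space"
  assumes "open S" "smooth_on S f" "x \<in> S"
  shows "frechet_derivative (\<lambda>y. frechet_derivative f (at y) v) (at x) w
    = frechet_derivative (\<lambda>y. frechet_derivative f (at y) w) (at x) v"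
proof (rule euclidean_eqI)
  fix b :: 'b
  have component: "frechet_derivative (\<lambda>y. frechet_derivative f (at y) v) (at x) w \<bullet> b
      = frechet_derivative (\<lambda>y. frechet_derivative (\<lambda>y. f y \<bullet> b) (at y) v) (at x) w" for v w
  proof -
    have bl: "bounded_linear (\<lambda>z. z \<bullet> b)" by (rule bounded_linear_inner_left)
    note sm = smooth_on_directional_derivative[OF assms(2), of v]
    have "frechet_derivative (\<lambda>y. frechet_derivative f (at y) v) (at x) w \<bullet> b
        = frechet_derivative (\<lambda>y. frechet_derivative f (at y) v \<bullet> b) (at x) w"
      using frechet_derivative_bounded_linear_compose[OF bl sm assms(3)] by simp
    also have "frechet_derivative (\<lambda>y. frechet_derivative f (at y) v \<bullet> b) (at x)
        = frechet_derivative (\<lambda>y. frechet_derivative (\<lambda>y. f y \<bullet> b) (at y) v) (at x)"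
    proof (rule frechet_derivative_cong_open[OF assms(1,3), symmetric])
      show "frechet_derivative f (at y) v \<bullet> b = frechet_derivative (\<lambda>y. f y \<bullet> b) (at y) v" if "y \<in> S" for y
        using frechet_derivative_bounded_linear_compose[OF bl assms(2) that] by simp
      show "((\<lambda>y. frechet_derivative f (at y) v \<bullet> b) has_derivative
          (\<lambda>h. frechet_derivative (\<lambda>y. frechet_derivative f (at y) v) (at x) h \<bullet> b)) (at x)"
        by (rule bounded_linear.has_derivative[OF bl smooth_on_has_derivative[OF sm assms(3)]])
    qed
    finally show ?thesis .
  qed
  have "smooth_on S (\<lambda>y. f y \<bullet> b)"
    by (intro smooth_on_inner assms smooth_on_const)
  then show "frechet_derivative (\<lambda>y. frechet_derivative f (at y) v) (at x) w \<bullet> b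
      = frechet_derivative (\<lambda>y. frechet_derivative f (at y) w) (at x) v \<bullet> b"
    unfolding component using assms by (intro mixed_derivatives_commute_real)
qed

lemma smooth_on_iter_partial: "smooth_on S u \<Longrightarrow> smooth_on S (iter_partial js u)"
  by (induction js) (auto intro: smooth_on_directional_derivative)

text \<open>
  Commuting adjacent derivatives shows that the ordering of a multiset chosen in \<open>partial\<close> is
  immaterial.
\<close>

lemma iter_partial_move_to_front:
  assumes "open S" "smooth_on S u" "i \<in> set js" "x \<in> S"
  shows "iter_partial js u x = iter_partial (i # remove1 i js) u x"
  using assms(3,4)
proof (induction js arbitrary: x)
  case (Cons j ks)
  show ?case
  proof (cases "i = j")
    case False
    then have "i \<in> set ks" using Cons.prems by simp
    let ?r = "remove1 i ks"
    have "frechet_derivative (iter_partial (i # ?r) u) (at x) = frechet_derivative (iter_partial ks u) (at x)"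
      by (rule frechet_derivative_cong_open[OF assms(1) Cons.prems(2) Cons.IH[OF \<open>i \<in> set ks\<close>]
            smooth_on_has_derivative[OF smooth_on_iter_partial[OF assms(2)] Cons.prems(2)]])
    then have "iter_partial (j # ks) u x = iter_partial (j # i # ?r) u x" by simp
    also have "\<dots> = iter_partial (i # j # ?r) u x"
      using mixed_derivatives_commute[OF assms(1) smooth_on_iter_partial[OF assms(2)] Cons.prems(2)]
      by simp
    finally show ?thesis using False by simp
  qed simp
qed simp

lemma iter_partial_permute:
  assumes "open S" "smooth_on S u" "mset js = mset ks" "x \<in> S"
  shows "iter_partial js u x = iter_partial ks u x"
  using assms(3,4)
proof (induction ks arbitrary: js x)
  case (Cons i ks)
  have "i \<in> set js" using mset_eq_setD[OF Cons.prems(1)] by simp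
  have "mset (remove1 i js) = mset ks" using Cons.prems(1) by simp
  then have "frechet_derivative (iter_partial ks u) (at x) = frechet_derivative (iter_partial (remove1 i js) u) (at x)"
    by (intro frechet_derivative_cong_open[OF assms(1) Cons.prems(2) Cons.IH
          smooth_on_has_derivative[OF smooth_on_iter_partial[OF assms(2)] Cons.prems(2)]])
  then show ?case
    using iter_partial_move_to_front[OF assms(1,2) \<open>i \<in> set js\<close> Cons.prems(2)] by simp
qed simp

lemma partial_mset:
  assumes "open S" "smooth_on S u" "x \<in> S"
  shows "partial (mset js) u x = iter_partial js u x"
  unfolding partial_def
  by (rule iter_partial_permute[OF assms(1,2) someI[of _ js] assms(3)]) simp

lemma smooth_on_partial: "smooth_on S u \<Longrightarrow> smooth_on S (partial J u)"
  unfolding partial_def by (rule smooth_on_iter_partial)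

lemma partial_add_mset:
  assumes "open S" "smooth_on S u" "x \<in> S"
  shows "partial (add_mset k J) u x = frechet_derivative (partial J u) (at x) (axis k 1)"
proof -
  have "mset (SOME js. mset js = J) = J" by (rule someI_ex[OF ex_mset])
  then have "partial (add_mset k J) u x = iter_partial (k # (SOME js. mset js = J)) u x"
    using partial_mset[OF assms, of "k # (SOME js. mset js = J)"] by simp
  then show ?thesis by (simp add: partial_def)
qed

lemma partial_empty [simp]: "partial {#} u = u"
  by (simp add: partial_def)

lemma Rep_jet_index_empty [simp]: "Rep_jet_index (Abs_jet_index {#} :: ('p, 'n) jet_index) = {#}"
  by (simp add: Abs_jet_index_inverse)

lemma prolong_empty [simp]: "prolong u x $ Abs_jet_index {#} = u x"
  by (simp add: prolong_def)

lemma smooth_on_prolong: "open S \<Longrightarrow> smooth_on S u \<Longrightarrow> smooth_on S (prolong u)"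
  unfolding prolong_def by (intro smooth_on_vec_lambda smooth_on_partial)

lemma frechet_derivative_prolong:
  fixes u :: "real ^ 'p::finite \<Rightarrow> real ^ 'q::finite" and J :: "('p, 'n) jet_index"
  assumes "open S" "smooth_on S u" "x \<in> S"
  shows "frechet_derivative (prolong u) (at x) (axis k 1) $ J = partial (add_mset k (Rep_jet_index J)) u x"
proof -
  have "frechet_derivative (prolong u) (at x) (axis k 1) $ J
      = frechet_derivative (\<lambda>x. prolong u x $ J) (at x) (axis k 1)"
    using frechet_derivative_bounded_linear_compose[OF bounded_linear_vec_nth
        smooth_on_prolong[OF assms(1,2)] assms(3), of J] by simp
  also have "(\<lambda>x. prolong u x $ J) = partial (Rep_jet_index J) u"
    by (simp add: prolong_def)
  finally show ?thesis
    by (simp add: partial_add_mset[OF assms])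
qed

section \<open>Total derivatives of functions on jet space\<close>

text \<open>
  The parameter \<open>\<eta>\<close> is carried along as a coordinate, so functions on jet space are functions of
  \<open>(\<eta>, x, w)\<close>; \<open>base\<close> is the projection to the space on which the group acts.
\<close>

definition base :: "real \<times> ('p::finite, 'q::finite, 'n::finite) jet \<Rightarrow> real \<times> (real ^ 'p) \<times> (real ^ 'q)" where
  "base \<theta> = (fst \<theta>, fst (snd \<theta>), snd (snd \<theta>) $ Abs_jet_index {#})"

text \<open>
  The direction \<open>w \<mapsto> (w\<^sub>J\<^sub>+\<^sub>k)\<^sub>J\<close> in which the fibre coordinates of a jet move when \<open>x\<close> moves in
  direction \<open>k\<close>. Coordinates of order \<open>n + 1\<close> do not exist and are replaced by \<open>0\<close>; the resulting
  total derivative is the correct one on functions that depend on coordinates of order less than \<open>n\<close>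
  only, which is what \<open>depends_on_order\<close> keeps track of.
\<close>

definition shift :: "'p::finite \<Rightarrow> ('p, 'q::finite, 'n::finite) jet_fibre \<Rightarrow> ('p, 'q, 'n) jet_fibre" where
  "shift k w = (\<chi> J. if size (Rep_jet_index J) < CARD('n)
     then w $ Abs_jet_index (add_mset k (Rep_jet_index J)) else 0)"

definition total_derivative ::
    "'p::finite \<Rightarrow> (real \<times> ('p, 'q::finite, 'n::finite) jet \<Rightarrow> 'b::euclidean_space) \<Rightarrow> real \<times> ('p, 'q, 'n) jet \<Rightarrow> 'b" where
  "total_derivative k Y \<theta> = frechet_derivative Y (at \<theta>) (0, axis k 1, shift k (snd (snd \<theta>)))"

definition agree :: "nat \<Rightarrow> ('p::finite, 'q::finite, 'n::finite) jet_fibre \<Rightarrow> ('p, 'q, 'n) jet_fibre \<Rightarrow> bool" where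
  "agree m w w' \<longleftrightarrow> (\<forall>J. size (Rep_jet_index J) \<le> m \<longrightarrow> w $ J = w' $ J)"

definition depends_on_order ::
    "(real \<times> ('p::finite, 'q::finite, 'n::finite) jet) set \<Rightarrow> nat \<Rightarrow> (real \<times> ('p, 'q, 'n) jet \<Rightarrow> 'b) \<Rightarrow> bool" where
  "depends_on_order S m Y \<longleftrightarrow>
     (\<forall>\<eta> x w w'. (\<eta>, x, w) \<in> S \<and> (\<eta>, x, w') \<in> S \<and> agree m w w' \<longrightarrow> Y (\<eta>, x, w) = Y (\<eta>, x, w'))"

lemma agree_mono: "agree m w w' \<Longrightarrow> k \<le> m \<Longrightarrow> agree k w w'"
  by (auto simp: agree_def)

lemma bounded_linear_base: "bounded_linear base"
  unfolding base_def
  by (intro bounded_linear_Pair bounded_linear_fst bounded_linear_fst_comp bounded_linear_snd_comp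
      bounded_linear_compose[OF bounded_linear_vec_nth] bounded_linear_ident)

lemma base_prolong [simp]: "base (\<eta>, x, prolong u x) = (\<eta>, x, u x)"
  by (simp add: base_def)

lemma shift_nth:
  assumes "size (Rep_jet_index J) < CARD('n)"
  shows "shift k w $ (J :: ('p::finite, 'n::finite) jet_index)
    = w $ Abs_jet_index (add_mset k (Rep_jet_index J))"
  using assms by (simp add: shift_def)

lemma smooth_on_shift:
  fixes f :: "'a::real_normed_vector \<Rightarrow> ('p::finite, 'q::finite, 'n::finite) jet_fibre"
  assumes "open S" "smooth_on S f"
  shows "smooth_on S (\<lambda>\<theta>. shift k (f \<theta>))"
  unfolding shift_def
proof (rule smooth_on_vec_lambda[OF assms(1)])
  fix J :: "('p, 'n) jet_index"
  show "smooth_on S (\<lambda>x. if size (Rep_jet_index J) < CARD('n)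
      then f x $ Abs_jet_index (add_mset k (Rep_jet_index J)) else 0)"
    using assms by (cases "size (Rep_jet_index J) < CARD('n)") (auto intro: smooth_on_vec_nth)
qed

lemma smooth_on_total_derivative:
  "open S \<Longrightarrow> smooth_on S Y \<Longrightarrow> smooth_on S (total_derivative k Y)"
  unfolding total_derivative_def
  by (intro smooth_on_derivative_apply smooth_on_Pair smooth_on_const smooth_on_shift
      smooth_on_snd smooth_on_id)

text \<open>
  The form in which independence of the high-order coordinates passes to derivatives: the lines start
  at two jets that differ in those coordinates and run in parallel.
\<close>

lemma directional_derivative_eqI:
  fixes f :: "'a::real_normed_vector \<Rightarrow> 'c::real_normed_vector" and g :: "'b::real_normed_vector \<Rightarrow> 'c"
  assumes "open S" "open T" "smooth_on S f" "smooth_on T g" "x \<in> S" "y \<in> T"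
    and eq: "\<And>t. x + t *\<^sub>R v \<in> S \<Longrightarrow> y + t *\<^sub>R w \<in> T \<Longrightarrow> f (x + t *\<^sub>R v) = g (y + t *\<^sub>R w)"
  shows "frechet_derivative f (at x) v = frechet_derivative g (at y) w"
proof -
  have line: "((\<lambda>t. h (z + t *\<^sub>R u)) has_vector_derivative frechet_derivative h (at z) u) (at 0)"
    if "smooth_on N h" "z \<in> N" for N and h :: "'d::real_normed_vector \<Rightarrow> 'c" and z u
  proof -
    have "((\<lambda>t. z + t *\<^sub>R u) has_derivative (\<lambda>s. s *\<^sub>R u)) (at 0)"
      by (auto intro!: derivative_eq_intros)
    moreover have "(h has_derivative frechet_derivative h (at z)) (at (z + 0 *\<^sub>R u))"
      using smooth_on_has_derivative[OF that] by simp
    ultimately have "((\<lambda>t. h (z + t *\<^sub>R u)) has_derivative (\<lambda>s. frechet_derivative h (at z) (s *\<^sub>R u))) (at 0)"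
      by (rule has_derivative_compose)
    then show ?thesis
      by (simp only: has_vector_derivative_def linear_scale[OF smooth_on_linear_derivative[OF that]])
  qed
  let ?N = "(\<lambda>t. x + t *\<^sub>R v) -` S \<inter> (\<lambda>t. y + t *\<^sub>R w) -` T"
  have "open ?N"
    by (intro open_Int open_vimage assms continuous_intros)
  then have "((\<lambda>t. g (y + t *\<^sub>R w)) has_vector_derivative frechet_derivative f (at x) v) (at 0)"
    by (rule has_vector_derivative_transform_within_open[OF line[OF assms(3,5)]])
       (use assms(5,6) eq in auto)
  then show ?thesis
    using line[OF assms(4,6)] by (rule vector_derivative_unique_at)
qed

lemma derivative_vanishes_above_order:
  assumes "open S" "smooth_on S Y" "depends_on_order S m Y" "(\<eta>, x, w) \<in> S"
    and \<tau>: "\<And>J. size (Rep_jet_index J) \<le> m \<Longrightarrow> \<tau> $ J = 0"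
  shows "frechet_derivative Y (at (\<eta>, x, w)) (0, 0, \<tau>) = 0"
proof -
  have "frechet_derivative Y (at (\<eta>, x, w)) (0, 0, \<tau>) = frechet_derivative Y (at (\<eta>, x, w)) 0"
  proof (rule directional_derivative_eqI[OF assms(1,1,2,2,4,4)])
    fix t :: real
    assume S: "(\<eta>, x, w) + t *\<^sub>R (0, 0, \<tau>) \<in> S" "(\<eta>, x, w) + t *\<^sub>R 0 \<in> S"
    have "agree m (w + t *\<^sub>R \<tau>) w"
      using \<tau> by (simp add: agree_def)
    then show "Y ((\<eta>, x, w) + t *\<^sub>R (0, 0, \<tau>)) = Y ((\<eta>, x, w) + t *\<^sub>R 0)"
      using S assms(3) by (simp add: depends_on_order_def)
  qed
  then show ?thesis
    using linear_0[OF smooth_on_linear_derivative[OF assms(2,4)]] by simp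
qed

lemma derivative_truncation:
  assumes "open S" "smooth_on S Y" "depends_on_order S m Y" "(\<eta>, x, w) \<in> S"
    and "agree m \<sigma> \<sigma>'"
  shows "frechet_derivative Y (at (\<eta>, x, w)) (s, v, \<sigma>) = frechet_derivative Y (at (\<eta>, x, w)) (s, v, \<sigma>')"
proof -
  let ?F = "frechet_derivative Y (at (\<eta>, x, w))"
  have "?F ((s, v, \<sigma>') + (0, 0, \<sigma> - \<sigma>')) = ?F (s, v, \<sigma>') + ?F (0, 0, \<sigma> - \<sigma>')"
    by (rule linear_add[OF smooth_on_linear_derivative[OF assms(2,4)]])
  also have "?F (0, 0, \<sigma> - \<sigma>') = 0"
    by (rule derivative_vanishes_above_order[OF assms(1-4)]) (use assms(5) in \<open>simp add: agree_def\<close>)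
  finally show ?thesis by simp
qed

lemma depends_on_order_total_derivative:
  fixes Y :: "real \<times> ('p::finite, 'q::finite, 'n::finite) jet \<Rightarrow> 'b::euclidean_space"
  assumes "open S" "smooth_on S Y" "depends_on_order S m Y" "m < CARD('n)"
  shows "depends_on_order S (Suc m) (total_derivative k Y)"
  unfolding depends_on_order_def
proof (intro allI impI, elim conjE)
  fix \<eta> x w w' assume S: "(\<eta>, x, w) \<in> S" "(\<eta>, x, w') \<in> S" and ww': "agree (Suc m) w w'"
  let ?\<sigma> = "shift k w"
  have "agree m ?\<sigma> (shift k w')"
    using ww' assms(4) by (auto simp: agree_def shift_nth Abs_jet_index_inverse)
  then have "total_derivative k Y (\<eta>, x, w') = frechet_derivative Y (at (\<eta>, x, w')) (0, axis k 1, ?\<sigma>)"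
    unfolding total_derivative_def using derivative_truncation[OF assms(1-3) S(2)] by simp
  also have "\<dots> = frechet_derivative Y (at (\<eta>, x, w)) (0, axis k 1, ?\<sigma>)"
  proof (rule directional_derivative_eqI[OF assms(1,1,2,2) S(2,1)])
    fix t :: real
    assume "(\<eta>, x, w') + t *\<^sub>R (0, axis k 1, ?\<sigma>) \<in> S" "(\<eta>, x, w) + t *\<^sub>R (0, axis k 1, ?\<sigma>) \<in> S"
    moreover have "agree m (w' + t *\<^sub>R ?\<sigma>) (w + t *\<^sub>R ?\<sigma>)"
      using ww' by (simp add: agree_def)
    ultimately show "Y ((\<eta>, x, w') + t *\<^sub>R (0, axis k 1, ?\<sigma>)) = Y ((\<eta>, x, w) + t *\<^sub>R (0, axis k 1, ?\<sigma>))"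
      using assms(3) by (simp add: depends_on_order_def)
  qed
  finally show "total_derivative k Y (\<eta>, x, w) = total_derivative k Y (\<eta>, x, w')"
    by (simp add: total_derivative_def)
qed

text \<open>
  The defining property of the total derivative. The fibre direction of the curve
  \<open>x \<mapsto> prolong u x\<close> and the truncated \<open>shift\<close> differ in the coordinates of top order only, and there the
  derivative of \<open>Y\<close> vanishes.
\<close>

lemma total_derivative_along_prolongation:
  fixes u :: "real ^ 'p::finite \<Rightarrow> real ^ 'q::finite"
    and Y :: "real \<times> ('p, 'q, 'n::finite) jet \<Rightarrow> 'b::euclidean_space"
  assumes "open \<Omega>" "smooth_on \<Omega> u" "x \<in> \<Omega>"
    and "open S" "smooth_on S Y" "depends_on_order S m Y" "m < CARD('n)" "(\<eta>, x, prolong u x) \<in> S"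
  shows "((\<lambda>x. Y (\<eta>, x, prolong u x)) has_derivative
      (\<lambda>v. frechet_derivative Y (at (\<eta>, x, prolong u x)) (0, v, frechet_derivative (prolong u) (at x) v))) (at x)"
    and "frechet_derivative (\<lambda>x. Y (\<eta>, x, prolong u x)) (at x) (axis k 1)
      = total_derivative k Y (\<eta>, x, prolong u x)"
proof -
  let ?w = "prolong u x :: ('p, 'q, 'n) jet_fibre"
  let ?F = "frechet_derivative Y (at (\<eta>, x, ?w))" and ?P = "frechet_derivative (prolong u) (at x)"
  have "((\<lambda>x. (\<eta>, x, prolong u x)) has_derivative (\<lambda>v. (0, v, ?P v))) (at x)"
    by (intro has_derivative_Pair has_derivative_const has_derivative_ident
        smooth_on_has_derivative[OF smooth_on_prolong[OF assms(1,2)] assms(3)])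
  then show der: "((\<lambda>x. Y (\<eta>, x, prolong u x)) has_derivative (\<lambda>v. ?F (0, v, ?P v))) (at x)"
    by (rule has_derivative_compose[where f = "\<lambda>x. (\<eta>, x, prolong u x)" and g = Y,
          OF _ smooth_on_has_derivative[OF assms(5,8)]])
  have "agree m (?P (axis k 1)) (shift k ?w)"
    using assms(7) frechet_derivative_prolong[OF assms(1-3)]
    by (auto simp: agree_def shift_nth prolong_def Abs_jet_index_inverse)
  then have "?F (0, axis k 1, ?P (axis k 1)) = ?F (0, axis k 1, shift k ?w)"
    by (rule derivative_truncation[OF assms(4-6,8)])
  then show "frechet_derivative (\<lambda>x. Y (\<eta>, x, prolong u x)) (at x) (axis k 1)
      = total_derivative k Y (\<eta>, x, prolong u x)"
    by (simp only: frechet_derivative_at[OF der, symmetric] total_derivative_def snd_conv)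
qed

section \<open>The prolonged action\<close>

lemma matrix_solve:
  fixes A :: "real ^ 'p::finite ^ 'p" and c :: "'p \<Rightarrow> 'b::real_vector"
  assumes "inj ((*v) A)" and b: "\<And>k. b k = (\<Sum>i\<in>UNIV. A $ k $ i *\<^sub>R c i)"
  shows "(\<Sum>k\<in>UNIV. (inv ((*v) A) (axis k 1) $ i) *\<^sub>R b k) = c i"
proof -
  let ?I = "inv ((*v) A)"
  have lin: "linear ?I"
    using assms(1) by (intro inj_linear_imp_inv_linear) auto
  have "(\<Sum>k\<in>UNIV. (?I (axis k 1) $ i) * A $ k $ j) = (if i = j then 1 else 0)" for j
  proof -
    have "A *v axis j 1 = (\<Sum>k\<in>UNIV. A $ k $ j *\<^sub>R axis k 1)"
      by (simp add: vec_eq_iff matrix_vector_mult_def axis_def if_distrib sum.If_cases cong: if_cong)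
    then have "axis j 1 = ?I (\<Sum>k\<in>UNIV. A $ k $ j *\<^sub>R axis k 1)"
      using inv_f_f[OF assms(1), of "axis j 1"] by simp
    also have "\<dots> = (\<Sum>k\<in>UNIV. A $ k $ j *\<^sub>R ?I (axis k 1))"
      by (simp only: linear_sum[OF lin] linear_scale[OF lin])
    finally have "axis j 1 $ i = (\<Sum>k\<in>UNIV. A $ k $ j *\<^sub>R ?I (axis k 1)) $ i" by simp
    then show ?thesis by (simp add: axis_def mult.commute)
  qed
  note inverse = this
  have "(\<Sum>k\<in>UNIV. (?I (axis k 1) $ i) *\<^sub>R b k)
      = (\<Sum>j\<in>UNIV. (\<Sum>k\<in>UNIV. (?I (axis k 1) $ i) * A $ k $ j) *\<^sub>R c j)"
    unfolding b scaleR_sum_right scaleR_sum_left scaleR_scaleR by (rule sum.swap)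
  also have "\<dots> = c i" by (simp add: inverse if_distrib[of "\<lambda>r. r *\<^sub>R _"] cong: if_cong)
  finally show ?thesis .
qed

locale smooth_local_action =
  fixes U :: "(real \<times> (real ^ 'p::finite) \<times> (real ^ 'q::finite)) set"
    and a :: "real \<times> (real ^ 'p) \<times> (real ^ 'q) \<Rightarrow> (real ^ 'p) \<times> (real ^ 'q)"
  assumes open_U: "open U" and smooth_a: "smooth_on U a"
begin

definition base_image :: "real \<times> ('p, 'q, 'n::finite) jet \<Rightarrow> real ^ 'p" where
  "base_image \<theta> = fst (a (base \<theta>))"

definition total_jacobian :: "real \<times> ('p, 'q, 'n::finite) jet \<Rightarrow> real ^ 'p ^ 'p" where
  "total_jacobian \<theta> = (\<chi> k i. total_derivative k base_image \<theta> $ i)"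

text \<open>
  Invertibility of the total Jacobian says that the graph of any function with the given jet is
  mapped, near the given point, to a graph again.
\<close>

definition regular_jets :: "(real \<times> ('p, 'q, 'n::finite) jet) set" where
  "regular_jets = {\<theta>. base \<theta> \<in> U \<and> det (total_jacobian \<theta>) \<noteq> 0}"

text \<open>
  Row \<open>k\<close> of the total Jacobian is the total derivative of the image point in direction \<open>k\<close>, so the
  coefficient below is the entry \<open>(i, k)\<close> of its inverse matrix. It is written with the inverse of the
  linear map because smoothness of the inverse is known in that form.
\<close>

fun prolonged_coordinate :: "'p list \<Rightarrow> real \<times> ('p, 'q, 'n::finite) jet \<Rightarrow> real ^ 'q" where
  "prolonged_coordinate [] \<theta> = snd (a (base \<theta>))"
| "prolonged_coordinate (i # js) \<theta> =
     (\<Sum>k\<in>UNIV. (inv ((*v) (total_jacobian \<theta>)) (axis k 1) $ i) *\<^sub>R total_derivative k (prolonged_coordinate js) \<theta>)"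

definition prolonged_action :: "real \<times> ('p, 'q, 'n::finite) jet \<Rightarrow> ('p, 'q, 'n) jet" where
  "prolonged_action \<theta> =
     (base_image \<theta>, \<chi> J. prolonged_coordinate (SOME js. mset js = Rep_jet_index J) \<theta>)"

lemma open_base_vimage: "open (base -` U)"
  by (intro open_vimage open_U linear_continuous_on bounded_linear_base)

lemma smooth_on_a_base: "smooth_on (base -` U) (\<lambda>\<theta>. a (base \<theta>))"
  by (rule smooth_on_compose[OF open_base_vimage open_U smooth_a smooth_on_bounded_linear[OF bounded_linear_base]]) auto

lemma smooth_on_base_image: "smooth_on (base -` U) base_image"
  unfolding base_image_def by (intro smooth_on_fst open_base_vimage smooth_on_a_base)

lemma smooth_on_total_jacobian_entry: "smooth_on (base -` U) (\<lambda>\<theta>. total_jacobian \<theta> $ k $ i)"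
  unfolding total_jacobian_def vec_lambda_beta
  by (intro smooth_on_vec_nth smooth_on_total_derivative smooth_on_base_image open_base_vimage)

lemma open_regular_jets: "open (regular_jets :: (real \<times> ('p, 'q, 'n::finite) jet) set)"
proof -
  have "continuous_on (base -` U) (\<lambda>\<theta> :: real \<times> ('p, 'q, 'n) jet. det (total_jacobian \<theta>))"
    unfolding det_def
    by (intro continuous_intros smooth_on_continuous_on[OF smooth_on_total_jacobian_entry])
  then have "open ((\<lambda>\<theta>. det (total_jacobian \<theta>)) -` (- {0}) \<inter> (base -` U :: (real \<times> ('p, 'q, 'n) jet) set))"
    using continuous_on_open_vimage[OF open_base_vimage] by (metis open_Compl closed_singleton)
  also have "(\<lambda>\<theta>. det (total_jacobian \<theta>)) -` (- {0}) \<inter> base -` U = regular_jets"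
    by (auto simp: regular_jets_def)
  finally show ?thesis .
qed

lemma regular_jets_subset: "regular_jets \<subseteq> base -` U"
  by (auto simp: regular_jets_def)

lemma bij_total_jacobian:
  assumes "\<theta> \<in> regular_jets" shows "bij ((*v) (total_jacobian \<theta>))"
proof -
  have "linear ((*v) (total_jacobian \<theta>))" by simp
  moreover have "inj ((*v) (total_jacobian \<theta>))"
    using assms det_nz_iff_inj[of "(*v) (total_jacobian \<theta>)"]
    by (simp add: regular_jets_def)
  ultimately show ?thesis
    by (simp add: bij_def linear_injective_imp_surjective)
qed

lemma smooth_on_inverse_total_jacobian:
  "smooth_on regular_jets (\<lambda>\<theta>. inv ((*v) (total_jacobian \<theta>)) v)"
proof (rule smooth_on_inverse_family[OF open_regular_jets])
  fix w
  show "smooth_on regular_jets (\<lambda>\<theta>. total_jacobian \<theta> *v w)"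
    unfolding matrix_vector_mult_def
    by (intro smooth_on_vec_lambda smooth_on_sum smooth_on_mult smooth_on_const open_regular_jets
        smooth_on_subset[OF smooth_on_total_jacobian_entry regular_jets_subset])
qed (auto simp: bij_total_jacobian)

lemma smooth_on_prolonged_coordinate: "smooth_on regular_jets (prolonged_coordinate js)"
proof (induction js)
  case Nil
  show ?case
    unfolding prolonged_coordinate.simps
    by (intro smooth_on_snd open_regular_jets smooth_on_subset[OF smooth_on_a_base regular_jets_subset])
next
  case (Cons i js)
  show ?case
    unfolding prolonged_coordinate.simps
    by (intro smooth_on_sum smooth_on_scaleR smooth_on_vec_nth open_regular_jets
        smooth_on_inverse_total_jacobian smooth_on_total_derivative Cons)
qed

lemma smooth_on_prolonged_action: "smooth_on regular_jets prolonged_action"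
  unfolding prolonged_action_def
  by (intro smooth_on_Pair smooth_on_vec_lambda open_regular_jets smooth_on_prolonged_coordinate
      smooth_on_subset[OF smooth_on_base_image regular_jets_subset])

lemma prolonged_action_0: "snd (prolonged_action \<theta>) $ Abs_jet_index {#} = snd (a (base \<theta>))"
  by (simp add: prolonged_action_def)

lemma depends_on_order_base_image: "depends_on_order S 0 (base_image :: _ \<Rightarrow> _)"
  by (auto simp: depends_on_order_def agree_def base_image_def base_def)

lemma depends_on_order_prolonged_coordinate:
  assumes "length js \<le> CARD('n::finite)"
  shows "depends_on_order regular_jets (length js)
    (prolonged_coordinate js :: real \<times> ('p, 'q, 'n) jet \<Rightarrow> _)"
  using assms
proof (induction js)
  case Nil
  show ?case by (auto simp: depends_on_order_def agree_def base_def)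
next
  case (Cons i js)
  show ?case
    unfolding depends_on_order_def
  proof (intro allI impI, elim conjE)
    fix \<eta> x and w w' :: "('p, 'q, 'n) jet_fibre"
    assume W: "(\<eta>, x, w) \<in> regular_jets" "(\<eta>, x, w') \<in> regular_jets"
      and ww': "agree (length (i # js)) w w'"
    have "depends_on_order regular_jets (Suc 0)
        (total_derivative k (base_image :: real \<times> ('p, 'q, 'n) jet \<Rightarrow> _))" for k
      by (rule depends_on_order_total_derivative[OF open_regular_jets
          smooth_on_subset[OF smooth_on_base_image regular_jets_subset] depends_on_order_base_image]) simp
    then have "total_derivative k base_image (\<eta>, x, w) = total_derivative k base_image (\<eta>, x, w')" for k
      using W agree_mono[OF ww', of "Suc 0"] unfolding depends_on_order_def by simp
    then have "total_jacobian (\<eta>, x, w) = total_jacobian (\<eta>, x, w')"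
      by (simp add: total_jacobian_def)
    moreover have "total_derivative k (prolonged_coordinate js) (\<eta>, x, w)
        = total_derivative k (prolonged_coordinate js) (\<eta>, x, w')" for k
      using depends_on_order_total_derivative[OF open_regular_jets smooth_on_prolonged_coordinate Cons.IH, of k]
        Cons.prems W ww'
      unfolding depends_on_order_def by simp
    ultimately show "prolonged_coordinate (i # js) (\<eta>, x, w) = prolonged_coordinate (i # js) (\<eta>, x, w')"
      by simp
  qed
qed

context
  fixes \<eta> :: real and \<Omega> :: "(real ^ 'p) set" and u :: "real ^ 'p \<Rightarrow> real ^ 'q"
  assumes \<Omega>: "open \<Omega>" and u: "smooth_on \<Omega> u" and dom: "\<And>x. x \<in> \<Omega> \<Longrightarrow> (\<eta>, x, u x) \<in> U"
begin

lemma smooth_on_image_map: "smooth_on \<Omega> (\<lambda>x. fst (a (\<eta>, x, u x)))"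
  using dom
  by (intro smooth_on_fst \<Omega> smooth_on_compose[OF \<Omega> open_U smooth_a] smooth_on_Pair u
      smooth_on_const smooth_on_id) auto

lemma derivative_image_map:
  assumes "x \<in> \<Omega>"
  shows "frechet_derivative (\<lambda>x. fst (a (\<eta>, x, u x))) (at x) (axis k 1)
    = total_derivative k base_image (\<eta>, x, prolong u x :: ('p, 'q, 'n::finite) jet_fibre)"
proof -
  have "(\<lambda>x. fst (a (\<eta>, x, u x))) = (\<lambda>x. base_image (\<eta>, x, prolong u x :: ('p, 'q, 'n) jet_fibre))"
    by (simp add: base_image_def)
  then show ?thesis
    using total_derivative_along_prolongation(2)[OF \<Omega> u assms open_base_vimage smooth_on_base_image
        depends_on_order_base_image, of \<eta> k] dom[OF assms]
    by simp
qed

lemma total_jacobian_prolong: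
  assumes "x \<in> \<Omega>"
  shows "total_jacobian (\<eta>, x, prolong u x :: ('p, 'q, 'n::finite) jet_fibre)
    = transpose (matrix (frechet_derivative (\<lambda>x. fst (a (\<eta>, x, u x))) (at x)))"
  by (simp add: total_jacobian_def transpose_def matrix_def vec_eq_iff
      derivative_image_map[OF assms, where 'n = 'n])

lemma regular_iff_inj:
  assumes "x \<in> \<Omega>"
  shows "(\<eta>, x, prolong u x :: ('p, 'q, 'n::finite) jet_fibre) \<in> regular_jets
    \<longleftrightarrow> inj (frechet_derivative (\<lambda>x. fst (a (\<eta>, x, u x))) (at x))"
  using dom[OF assms] det_nz_iff_inj[OF smooth_on_linear_derivative[OF smooth_on_image_map assms]]
  by (simp add: regular_jets_def total_jacobian_prolong[OF assms, where 'n = 'n] det_transpose)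

text \<open>
  Differentiating the identity for \<open>js\<close> in direction \<open>k\<close> gives, by the chain rule, a linear system
  for the derivatives \<open>\<partial>\<^sub>i\<close> of the transformed function, with the total Jacobian as its matrix;
  \<open>prolonged_coordinate\<close> is its solution.
\<close>

lemma prolonged_coordinate_prolong:
  fixes \<Omega>' u'
  assumes "open \<Omega>'" "smooth_on \<Omega>' u'"
    and reg: "\<And>x. x \<in> \<Omega> \<Longrightarrow> (\<eta>, x, prolong u x :: ('p, 'q, 'n::finite) jet_fibre) \<in> regular_jets"
    and graph: "\<And>x. x \<in> \<Omega> \<Longrightarrow> fst (a (\<eta>, x, u x)) \<in> \<Omega>'"
      "\<And>x. x \<in> \<Omega> \<Longrightarrow> u' (fst (a (\<eta>, x, u x))) = snd (a (\<eta>, x, u x))"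
    and "length js \<le> CARD('n)" "x \<in> \<Omega>"
  shows "prolonged_coordinate js (\<eta>, x, prolong u x :: ('p, 'q, 'n) jet_fibre)
    = iter_partial js u' (fst (a (\<eta>, x, u x)))"
  using assms(6,7)
proof (induction js arbitrary: x)
  case Nil
  then show ?case using graph(2) by simp
next
  case (Cons i js)
  let ?\<theta> = "\<lambda>x. (\<eta>, x, prolong u x :: ('p, 'q, 'n) jet_fibre)"
  let ?\<chi> = "\<lambda>x. fst (a (\<eta>, x, u x))"
  let ?v = "iter_partial js u'"
  note v = smooth_on_iter_partial[OF assms(2), of js]
  note order = Suc_le_lessD[OF Cons.prems(1)[unfolded length_Cons]]
  note along = total_derivative_along_prolongation[OF \<Omega> u Cons.prems(2) open_regular_jets
      smooth_on_prolonged_coordinate depends_on_order_prolonged_coordinate[OF less_imp_le[OF order]]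
      order reg[OF Cons.prems(2)]]
  have IH: "prolonged_coordinate js (?\<theta> y) = ?v (?\<chi> y)" if "y \<in> \<Omega>" for y
    using Cons.IH Cons.prems(1) that by simp
  let ?c = "\<lambda>i. frechet_derivative ?v (at (?\<chi> x)) (axis i 1)"
  have "total_derivative k (prolonged_coordinate js) (?\<theta> x)
      = (\<Sum>i\<in>UNIV. total_jacobian (?\<theta> x) $ k $ i *\<^sub>R ?c i)" for k
  proof -
    note v_der = smooth_on_has_derivative[OF v graph(1)[OF Cons.prems(2)]]
    have der: "((\<lambda>x. ?v (?\<chi> x)) has_derivative
        (\<lambda>h. frechet_derivative ?v (at (?\<chi> x)) (frechet_derivative ?\<chi> (at x) h))) (at x)"
      by (rule has_derivative_compose[where f = ?\<chi> and g = ?v,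
            OF smooth_on_has_derivative[OF smooth_on_image_map Cons.prems(2)] v_der])
    have "total_derivative k (prolonged_coordinate js) (?\<theta> x)
        = frechet_derivative (\<lambda>x. prolonged_coordinate js (?\<theta> x)) (at x) (axis k 1)"
      by (simp only: along(2))
    also have "frechet_derivative (\<lambda>x. prolonged_coordinate js (?\<theta> x)) (at x)
        = frechet_derivative (\<lambda>x. ?v (?\<chi> x)) (at x)"
      by (rule frechet_derivative_cong_open[OF \<Omega> Cons.prems(2) IH along(1), symmetric])
    also have "frechet_derivative (\<lambda>x. ?v (?\<chi> x)) (at x) (axis k 1)
        = frechet_derivative ?v (at (?\<chi> x)) (frechet_derivative ?\<chi> (at x) (axis k 1))"
      by (simp only: frechet_derivative_at[OF der, symmetric])
    also have "frechet_derivative ?\<chi> (at x) (axis k 1) = (\<Sum>i\<in>UNIV. total_jacobian (?\<theta> x) $ k $ i *\<^sub>R axis i 1)"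
      unfolding derivative_image_map[OF Cons.prems(2), where 'n = 'n] total_jacobian_def vec_lambda_beta
      using basis_expansion[of "total_derivative k base_image (?\<theta> x)"]
      by (simp add: scalar_mult_eq_scaleR)
    also have "frechet_derivative ?v (at (?\<chi> x)) \<dots> = (\<Sum>i\<in>UNIV. total_jacobian (?\<theta> x) $ k $ i *\<^sub>R ?c i)"
      by (simp only: linear_sum[OF has_derivative_linear[OF v_der]] linear_scale[OF has_derivative_linear[OF v_der]])
    finally show ?thesis .
  qed
  from matrix_solve[OF bij_is_inj[OF bij_total_jacobian[OF reg[OF Cons.prems(2)]]] this]
  show ?case by simp
qed

lemma prolonged_action_prolong:
  assumes "open \<Omega>'" "smooth_on \<Omega>' u'"
    and reg: "\<And>x. x \<in> \<Omega> \<Longrightarrow> (\<eta>, x, prolong u x :: ('p, 'q, 'n::finite) jet_fibre) \<in> regular_jets"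
    and graph: "\<And>x. x \<in> \<Omega> \<Longrightarrow> fst (a (\<eta>, x, u x)) \<in> \<Omega>'"
      "\<And>x. x \<in> \<Omega> \<Longrightarrow> u' (fst (a (\<eta>, x, u x))) = snd (a (\<eta>, x, u x))"
    and "x \<in> \<Omega>"
  shows "prolonged_action (\<eta>, x, prolong u x :: ('p, 'q, 'n) jet_fibre)
    = (fst (a (\<eta>, x, u x)), prolong u' (fst (a (\<eta>, x, u x))))"
proof -
  let ?\<theta> = "(\<eta>, x, prolong u x :: ('p, 'q, 'n) jet_fibre)"
  have "prolonged_coordinate (SOME js. mset js = Rep_jet_index J) ?\<theta>
      = partial (Rep_jet_index J) u' (fst (a (\<eta>, x, u x)))" for J :: "('p, 'n) jet_index"
    unfolding partial_def
  proof (rule prolonged_coordinate_prolong[OF assms(1-5) _ assms(6)])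
    have "mset (SOME js. mset js = Rep_jet_index J) = Rep_jet_index J"
      by (rule someI_ex[OF ex_mset])
    then show "length (SOME js. mset js = Rep_jet_index J) \<le> CARD('n)"
      using Rep_jet_index[of J] by (metis mem_Collect_eq size_mset)
  qed
  then show ?thesis
    by (simp add: prolonged_action_def base_image_def prolong_def[of u'])
qed

end

end

section \<open>Symmetry groups\<close>

lemma graph_on_iff: "(x, y) \<in> graph_on \<Omega> u \<longleftrightarrow> x \<in> \<Omega> \<and> y = u x"
  by (auto simp: graph_on_def)

locale one_parameter_action =
  fixes \<eta>\<^sub>o :: real and M :: "((real ^ 'p::finite) \<times> (real ^ 'q::finite)) set"
    and U :: "(real \<times> (real ^ 'p) \<times> (real ^ 'q)) set"
    and g :: "real \<Rightarrow> (real ^ 'p) \<times> (real ^ 'q) \<Rightarrow> (real ^ 'p) \<times> (real ^ 'q)"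
  assumes local_group: "local_transformation_group \<eta>\<^sub>o M U g"
begin

sublocale smooth_local_action U "\<lambda>(\<eta>, z). g \<eta> z"
  using local_group by unfold_locales (simp_all add: local_transformation_group_def)

lemma domain_subset: "(\<eta>, z) \<in> U \<Longrightarrow> \<eta> \<in> {-\<eta>\<^sub>o<..<\<eta>\<^sub>o} \<and> z \<in> M"
  using local_group by (auto simp: local_transformation_group_def)

lemma g_in_M: "(\<eta>, z) \<in> U \<Longrightarrow> g \<eta> z \<in> M"
  using local_group by (auto simp: local_transformation_group_def)

lemma g_inverse: "(\<eta>, z) \<in> U \<Longrightarrow> (- \<eta>, g \<eta> z) \<in> U \<and> g (- \<eta>) (g \<eta> z) = z"
  using local_group by (auto simp: local_transformation_group_def)

lemma open_graph_domain:
  assumes "open \<Omega>" "smooth_on \<Omega> u"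
  shows "open {x \<in> \<Omega>. (\<eta>, x, u x) \<in> U}"
proof -
  have "continuous_on \<Omega> (\<lambda>x. (\<eta>, x, u x))"
    by (intro continuous_intros smooth_on_continuous_on[OF assms(2)])
  then have "open ((\<lambda>x. (\<eta>, x, u x)) -` U \<inter> \<Omega>)"
    using continuous_on_open_vimage[OF assms(1)] open_U by blast
  also have "(\<lambda>x. (\<eta>, x, u x)) -` U \<inter> \<Omega> = {x \<in> \<Omega>. (\<eta>, x, u x) \<in> U}" by auto
  finally show ?thesis .
qed

text \<open>
  Regularity of the jet is a consequence of the existence of the transform: the inverse group element,
  restricted to the graph of \<open>u'\<close>, is a smooth left inverse of \<open>x \<mapsto> fst (g \<eta> (x, u x))\<close>, whose
  derivative is therefore injective.
\<close>

lemma prolonged_action_transform: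
  fixes x :: "real ^ 'p"
  assumes "open \<Omega>" "smooth_on \<Omega> u" and tr: "is_transform U g \<eta> \<Omega> u \<Omega>' u'"
    and x: "x \<in> \<Omega>" "(\<eta>, x, u x) \<in> U"
  shows "(\<eta>, x, prolong u x :: ('p, 'q, 'n::finite) jet_fibre) \<in> regular_jets"
    and "prolonged_action (\<eta>, x, prolong u x :: ('p, 'q, 'n) jet_fibre)
      = (fst (g \<eta> (x, u x)), prolong u' (fst (g \<eta> (x, u x))))"
proof -
  define \<Omega>1 where "\<Omega>1 = {x \<in> \<Omega>. (\<eta>, x, u x) \<in> U}"
  have \<Omega>1: "open \<Omega>1" "\<Omega>1 \<subseteq> \<Omega>"
    unfolding \<Omega>1_def using open_graph_domain[OF assms(1,2)] by auto
  have u1: "smooth_on \<Omega>1 u" by (rule smooth_on_subset[OF assms(2) \<Omega>1(2)])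
  have dom: "(\<eta>, x, u x) \<in> U" if "x \<in> \<Omega>1" for x using that by (simp add: \<Omega>1_def)
  have \<Omega>': "open \<Omega>'" "smooth_on \<Omega>' u'"
    and graph: "graph_on \<Omega>' u' = g \<eta> ` {z \<in> graph_on \<Omega> u. (\<eta>, z) \<in> U}"
    using tr by (auto simp: is_transform_def)
  let ?\<chi> = "\<lambda>x. fst (g \<eta> (x, u x))"
  have image: "?\<chi> x \<in> \<Omega>'" "u' (?\<chi> x) = snd (g \<eta> (x, u x))" if "x \<in> \<Omega>1" for x
  proof -
    have "g \<eta> (x, u x) \<in> graph_on \<Omega>' u'"
      unfolding graph using that by (auto simp: \<Omega>1_def graph_on_iff)
    then show "?\<chi> x \<in> \<Omega>'" "u' (?\<chi> x) = snd (g \<eta> (x, u x))"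
      using graph_on_iff[of "?\<chi> x" "snd (g \<eta> (x, u x))"] by auto
  qed
  define \<Omega>2 where "\<Omega>2 = {y \<in> \<Omega>'. (- \<eta>, y, u' y) \<in> U}"
  have \<Omega>2: "open \<Omega>2" "\<Omega>2 \<subseteq> \<Omega>'"
    unfolding \<Omega>2_def using open_graph_domain[OF \<Omega>'] by auto
  let ?T = "\<lambda>y. fst (g (- \<eta>) (y, u' y))"
  have T: "smooth_on \<Omega>2 ?T"
    using smooth_on_image_map[OF \<Omega>2(1) smooth_on_subset[OF \<Omega>'(2) \<Omega>2(2)], of "- \<eta>"]
    by (simp add: \<Omega>2_def)
  have \<chi>: "smooth_on \<Omega>1 ?\<chi>"
    using smooth_on_image_map[OF \<Omega>1(1) u1 dom] by simp
  have inverse: "?\<chi> x \<in> \<Omega>2" "?T (?\<chi> x) = x" if "x \<in> \<Omega>1" for x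
  proof -
    have "(?\<chi> x, u' (?\<chi> x)) = g \<eta> (x, u x)" using image(2)[OF that] by simp
    then show "?\<chi> x \<in> \<Omega>2" "?T (?\<chi> x) = x"
      using g_inverse[OF dom[OF that]] image(1)[OF that] by (simp_all add: \<Omega>2_def)
  qed
  have inj: "inj (frechet_derivative ?\<chi> (at x))" if "x \<in> \<Omega>1" for x
  proof -
    let ?A = "frechet_derivative ?\<chi> (at x)" and ?B = "frechet_derivative ?T (at (?\<chi> x))"
    have "((\<lambda>x. ?T (?\<chi> x)) has_derivative (\<lambda>v. ?B (?A v))) (at x)"
      by (rule has_derivative_compose[where f = ?\<chi> and g = ?T,
            OF smooth_on_has_derivative[OF \<chi> that] smooth_on_has_derivative[OF T inverse(1)[OF that]]])
    then have "((\<lambda>x. x) has_derivative (\<lambda>v. ?B (?A v))) (at x)"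
      by (rule has_derivative_transform_within_open[OF _ \<Omega>1(1) that]) (rule inverse(2))
    then have "(\<lambda>v. ?B (?A v)) = (\<lambda>v. v)"
      by (rule has_derivative_unique[OF _ has_derivative_ident])
    from fun_cong[OF this] show ?thesis by (rule inj_on_inverseI)
  qed
  have reg: "(\<eta>, x, prolong u x :: ('p, 'q, 'n) jet_fibre) \<in> regular_jets" if "x \<in> \<Omega>1" for x
    using regular_iff_inj[OF \<Omega>1(1) u1 dom that, where 'n = 'n] inj[OF that] by simp
  have x1: "x \<in> \<Omega>1" using x by (simp add: \<Omega>1_def)
  show "(\<eta>, x, prolong u x :: ('p, 'q, 'n) jet_fibre) \<in> regular_jets"
    by (rule reg[OF x1])
  show "prolonged_action (\<eta>, x, prolong u x :: ('p, 'q, 'n) jet_fibre)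
      = (fst (g \<eta> (x, u x)), prolong u' (fst (g \<eta> (x, u x))))"
    using prolonged_action_prolong[OF \<Omega>1(1) u1 dom \<Omega>' reg _ _ x1] image by simp
qed

text \<open>
  Over a regular jet \<open>x \<mapsto> fst (g \<eta> (x, u x))\<close> has a local smooth inverse \<open>T\<close>, and the transform is
  \<open>y \<mapsto> snd (g \<eta> (T y, u (T y)))\<close>.
\<close>

lemma local_transform_exists:
  assumes "open \<Omega>" "smooth_on \<Omega> u" "x \<in> \<Omega>"
    and reg: "(\<eta>, x, prolong u x :: ('p, 'q, 'n::finite) jet_fibre) \<in> regular_jets"
  obtains \<Omega>0 \<Omega>' u' where "open \<Omega>0" "\<Omega>0 \<subseteq> \<Omega>" "x \<in> \<Omega>0" "is_transform U g \<eta> \<Omega>0 u \<Omega>' u'"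
    "fst (g \<eta> (x, u x)) \<in> \<Omega>'"
proof -
  define \<Omega>1 where "\<Omega>1 = {x \<in> \<Omega>. (\<eta>, x, u x) \<in> U}"
  have \<Omega>1: "open \<Omega>1" "\<Omega>1 \<subseteq> \<Omega>"
    unfolding \<Omega>1_def using open_graph_domain[OF assms(1,2)] by auto
  have u1: "smooth_on \<Omega>1 u" by (rule smooth_on_subset[OF assms(2) \<Omega>1(2)])
  have dom: "(\<eta>, x, u x) \<in> U" if "x \<in> \<Omega>1" for x using that by (simp add: \<Omega>1_def)
  have x1: "x \<in> \<Omega>1"
    using reg regular_jets_subset assms(3) by (auto simp: \<Omega>1_def)
  let ?\<chi> = "\<lambda>x. fst (g \<eta> (x, u x))"
  have \<chi>: "smooth_on \<Omega>1 ?\<chi>"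
    using smooth_on_image_map[OF \<Omega>1(1) u1 dom] by simp
  have "inj (frechet_derivative ?\<chi> (at x))"
    using regular_iff_inj[OF \<Omega>1(1) u1 dom x1, where 'n = 'n] reg by simp
  then obtain \<Omega>0 \<Omega>' T where \<Omega>0: "open \<Omega>0" "\<Omega>0 \<subseteq> \<Omega>1" "x \<in> \<Omega>0" and \<Omega>': "open \<Omega>'" "?\<chi> x \<in> \<Omega>'"
    and hom: "homeomorphism \<Omega>0 \<Omega>' ?\<chi> T" and T: "smooth_on \<Omega>' T"
    by (rule smooth_inverse_function[OF \<Omega>1(1) \<chi> x1])
  have \<chi>0: "?\<chi> x \<in> \<Omega>'" "T (?\<chi> x) = x" if "x \<in> \<Omega>0" for x
    using hom that by (auto simp: homeomorphism_def)
  have T0: "T y \<in> \<Omega>0" "?\<chi> (T y) = y" if "y \<in> \<Omega>'" for y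
    using hom that by (auto simp: homeomorphism_def)
  define u' where "u' y = snd (g \<eta> (T y, u (T y)))" for y
  have "smooth_on \<Omega>1 (\<lambda>x. snd (g \<eta> (x, u x)))"
    using smooth_on_snd[OF \<Omega>1(1) smooth_on_compose[OF \<Omega>1(1) open_U smooth_a
          smooth_on_Pair[OF \<Omega>1(1) smooth_on_const smooth_on_Pair[OF \<Omega>1(1) smooth_on_id u1]]], of \<eta>]
      dom by auto
  then have "smooth_on \<Omega>' u'"
    unfolding u'_def
    by (rule smooth_on_compose[OF \<Omega>'(1) \<Omega>1(1) _ T]) (use T0 \<Omega>0(2) in auto)
  moreover have "graph_on \<Omega>' u' = g \<eta> ` {z \<in> graph_on \<Omega>0 u. (\<eta>, z) \<in> U}"
  proof (intro set_eqI iffI)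
    fix z assume "z \<in> graph_on \<Omega>' u'"
    then obtain y where y: "y \<in> \<Omega>'" "z = (y, u' y)" by (auto simp: graph_on_def)
    then have "z = g \<eta> (T y, u (T y))"
      using T0(2)[OF y(1)] by (simp add: u'_def prod_eq_iff)
    moreover have "(T y, u (T y)) \<in> {z \<in> graph_on \<Omega>0 u. (\<eta>, z) \<in> U}"
      using T0(1)[OF y(1)] \<Omega>0(2) dom by (auto simp: graph_on_iff)
    ultimately show "z \<in> g \<eta> ` {z \<in> graph_on \<Omega>0 u. (\<eta>, z) \<in> U}" by blast
  next
    fix z assume "z \<in> g \<eta> ` {z \<in> graph_on \<Omega>0 u. (\<eta>, z) \<in> U}"
    then obtain y where y: "y \<in> \<Omega>0" "z = g \<eta> (y, u y)" by (auto simp: graph_on_def)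
    then have "fst z \<in> \<Omega>'" "snd z = u' (fst z)"
      using \<chi>0[OF y(1)] by (simp_all add: u'_def)
    then show "z \<in> graph_on \<Omega>' u'" by (metis graph_on_iff prod.collapse)
  qed
  ultimately have "is_transform U g \<eta> \<Omega>0 u \<Omega>' u'"
    using \<Omega>'(1) by (simp add: is_transform_def)
  with \<Omega>0 \<Omega>1(2) \<Omega>'(2) that show ?thesis by blast
qed

end

lemma is_solution_subset:
  assumes "is_solution M \<Delta> \<Omega> u" "open \<Omega>0" "\<Omega>0 \<subseteq> \<Omega>"
  shows "is_solution M \<Delta> \<Omega>0 u"
  using assms smooth_on_subset by (auto simp: is_solution_def)

text \<open>
  By local solvability a zero of \<open>\<Delta>\<close> is the jet of an actual solution, and regularity of that jet
  makes the transform of a small piece of the solution exist; by symmetry it is again a solution.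
\<close>

lemma prolonged_action_preserves_zero_set:
  fixes M :: "((real ^ 'p::finite) \<times> (real ^ 'q::finite)) set"
    and \<Delta> :: "('p, 'q, 'n::finite) jet \<Rightarrow> real ^ 'l::finite"
  assumes "locally_solvable M \<Delta>" and sym: "symmetry_group M \<Delta> \<eta>\<^sub>o U g"
    and reg: "(\<eta>, z) \<in> smooth_local_action.regular_jets U (\<lambda>(\<eta>, z). g \<eta> z)" and zero: "\<Delta> z = 0"
  shows "\<Delta> (smooth_local_action.prolonged_action (\<lambda>(\<eta>, z). g \<eta> z) (\<eta>, z)) = 0"
proof -
  interpret one_parameter_action \<eta>\<^sub>o M U g
    using sym by unfold_locales (simp add: symmetry_group_def)
  obtain x w where z: "z = (x, w)" by (cases z)
  have dom: "(\<eta>, x, w $ Abs_jet_index {#}) \<in> U"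
    using reg regular_jets_subset by (auto simp: z base_def)
  then have "z \<in> zero_set M \<Delta>"
    using domain_subset zero by (auto simp: zero_set_def jet_space_def z)
  then obtain \<Omega> u where x: "x \<in> \<Omega>" and u: "is_solution M \<Delta> \<Omega> u" and w: "prolong u x = w"
    using assms(1) by (auto simp: locally_solvable_def z)
  have \<Omega>: "open \<Omega>" "smooth_on \<Omega> u" using u by (auto simp: is_solution_def)
  have reg': "(\<eta>, x, prolong u x :: ('p, 'q, 'n) jet_fibre) \<in> regular_jets"
    using reg by (simp add: z w)
  obtain \<Omega>0 \<Omega>' u' where \<Omega>0: "open \<Omega>0" "\<Omega>0 \<subseteq> \<Omega>" "x \<in> \<Omega>0" and tr: "is_transform U g \<eta> \<Omega>0 u \<Omega>' u'"
    and image: "fst (g \<eta> (x, u x)) \<in> \<Omega>'"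
    by (rule local_transform_exists[OF \<Omega> x reg'])
  have "is_solution M \<Delta> \<Omega>' u'"
    using sym is_solution_subset[OF u \<Omega>0(1,2)] tr domain_subset[OF dom]
    unfolding symmetry_group_def by blast
  then have "\<Delta> (fst (g \<eta> (x, u x)), prolong u' (fst (g \<eta> (x, u x)))) = 0"
    using image by (simp add: is_solution_def)
  moreover have "(\<eta>, x, u x) \<in> U" using dom w by auto
  ultimately show ?thesis
    using prolonged_action_transform(2)[OF \<Omega>0(1) smooth_on_subset[OF \<Omega>(2) \<Omega>0(2)] tr \<Omega>0(3), where 'n = 'n]
    by (simp add: z w)
qed

lemma open_jet_space: "open M \<Longrightarrow> open (jet_space M :: ('p::finite, 'q::finite, 'n) jet set)"
proof -
  assume "open M"
  have "jet_space M = (\<lambda>z :: ('p, 'q, 'n) jet. (fst z, snd z $ Abs_jet_index {#})) -` M"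
    by (auto simp: jet_space_def)
  also have "open \<dots>"
    by (intro open_vimage \<open>open M\<close> continuous_intros)
  finally show ?thesis .
qed

theorem theorem3p4:
  fixes M :: "((real ^ 'p::finite) \<times> (real ^ 'q::finite)) set"
    and \<Delta> :: "('p, 'q, 'n::finite) jet \<Rightarrow> real ^ 'l::finite"
    and \<eta>\<^sub>o :: real
    and U :: "(real \<times> (real ^ 'p) \<times> (real ^ 'q)) set"
    and g :: "real \<Rightarrow> (real ^ 'p) \<times> (real ^ 'q) \<Rightarrow> (real ^ 'p) \<times> (real ^ 'q)"
    and \<Xi> :: "real \<Rightarrow> (real ^ 'p) \<times> (real ^ 'q) \<Rightarrow> real ^ 'p"
    and \<Phi> :: "real \<Rightarrow> (real ^ 'p) \<times> (real ^ 'q) \<Rightarrow> real ^ 'q"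
  assumes "open M"
    and "smooth_on (jet_space M) \<Delta>"
    and "nondegenerate M \<Delta>"
    and "symmetry_group M \<Delta> \<eta>\<^sub>o U g"
    and "\<And>\<eta> x v. (\<eta>, x, v) \<in> U \<Longrightarrow> g \<eta> (x, v) = (\<Xi> \<eta> (x, v), \<Phi> \<eta> (x, v))"
  shows "\<exists>(V :: real \<Rightarrow> ('p, 'q, 'n) jet set)
            (Q :: 'l \<Rightarrow> 'l \<Rightarrow> real \<times> ('p, 'q, 'n) jet \<Rightarrow> real).
      (\<forall>\<eta>\<in>{-\<eta>\<^sub>o<..<\<eta>\<^sub>o}. V \<eta> \<subseteq> jet_space M) \<and>
      open (Sigma {-\<eta>\<^sub>o<..<\<eta>\<^sub>o} V) \<and>
      (\<forall>\<mu> \<nu>. smooth_on (Sigma {-\<eta>\<^sub>o<..<\<eta>\<^sub>o} V) (Q \<mu> \<nu>)) \<and>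
      (\<forall>\<eta> \<Omega> u \<Omega>' g\<eta>u.
         \<eta> \<in> {-\<eta>\<^sub>o<..<\<eta>\<^sub>o} \<and> open \<Omega> \<and> smooth_on \<Omega> u \<and> is_transform U g \<eta> \<Omega> u \<Omega>' g\<eta>u \<longrightarrow>
         (\<forall>x\<in>\<Omega>. (\<eta>, x, u x) \<in> U \<and> \<Xi> \<eta> (x, u x) \<in> \<Omega>' \<longrightarrow>
            (x, prolong u x) \<in> V \<eta> \<and>
            (\<forall>\<nu>. \<Delta> (\<Xi> \<eta> (x, u x), prolong g\<eta>u (\<Xi> \<eta> (x, u x))) $ \<nu> =
                 (\<Sum>\<mu>\<in>UNIV. Q \<mu> \<nu> (\<eta>, x, prolong u x) * \<Delta> (x, prolong u x) $ \<mu>))))"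
proof -
  interpret one_parameter_action \<eta>\<^sub>o M U g
    using assms(4) by unfold_locales (simp add: symmetry_group_def)
  let ?W = "regular_jets :: (real \<times> ('p, 'q, 'n) jet) set"
  let ?I = "{-\<eta>\<^sub>o<..<\<eta>\<^sub>o}"
  have rank: "maximal_rank M \<Delta>" and solvable: "locally_solvable M \<Delta>"
    using assms(3) by (auto simp: nondegenerate_def)
  have W_jets: "fst \<theta> \<in> ?I" "snd \<theta> \<in> jet_space M" "prolonged_action \<theta> \<in> jet_space M" if "\<theta> \<in> ?W" for \<theta>
  proof -
    have dom: "base \<theta> \<in> U" using that regular_jets_subset by auto
    then show "fst \<theta> \<in> ?I" "snd \<theta> \<in> jet_space M"
      using domain_subset[of "fst \<theta>" "snd (base \<theta>)"]
      by (auto simp: base_def jet_space_def)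
    have "(fst (prolonged_action \<theta>), snd (prolonged_action \<theta>) $ Abs_jet_index {#}) = g (fst (base \<theta>)) (snd (base \<theta>))"
      by (simp add: prolonged_action_0 case_prod_beta) (simp add: prolonged_action_def base_image_def case_prod_beta)
    then show "prolonged_action \<theta> \<in> jet_space M"
      using g_in_M[of "fst (base \<theta>)" "snd (base \<theta>)"] dom
      by (auto simp: jet_space_def case_prod_beta)
  qed
  have D: "smooth_on ?W (\<lambda>\<theta>. \<Delta> (snd \<theta>))"
    using W_jets(2)
    by (intro smooth_on_compose[OF open_regular_jets open_jet_space[OF assms(1)] assms(2)]
        smooth_on_snd open_regular_jets smooth_on_id) auto
  have F: "smooth_on ?W (\<lambda>\<theta>. \<Delta> (prolonged_action \<theta>))"
    using W_jets(3)
    by (intro smooth_on_compose[OF open_regular_jets open_jet_space[OF assms(1)] assms(2)]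
        smooth_on_prolonged_action) auto
  have surj: "surj (frechet_derivative (\<lambda>\<theta>. \<Delta> (snd \<theta>)) (at \<theta>))"
    if \<theta>: "\<theta> \<in> ?W" and zero: "\<Delta> (snd \<theta>) = 0" for \<theta>
  proof -
    let ?d = "frechet_derivative \<Delta> (at (snd \<theta>))"
    note lin = smooth_on_linear_derivative[OF assms(2) W_jets(2)[OF \<theta>]]
    have "((\<lambda>\<theta>. \<Delta> (snd \<theta>)) has_derivative (\<lambda>h. ?d (snd h))) (at \<theta>)"
      by (rule has_derivative_compose[where f = snd and g = \<Delta>,
            OF has_derivative_snd[OF has_derivative_ident] smooth_on_has_derivative[OF assms(2) W_jets(2)[OF \<theta>]]])
    then have "frechet_derivative (\<lambda>\<theta>. \<Delta> (snd \<theta>)) (at \<theta>) = (\<lambda>h. ?d (snd h))"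
      using frechet_derivative_at by metis
    moreover have "range ?d = UNIV"
    proof -
      have "dim (range ?d) = DIM(real ^ 'l)"
        using rank W_jets(2)[OF \<theta>] zero by (cases "snd \<theta>") (simp add: maximal_rank_def zero_set_def)
      then have "span (range ?d) = UNIV" using dim_eq_full by blast
      moreover have "subspace (range ?d)"
        using lin linear_subspace_image subspace_UNIV by blast
      ultimately show ?thesis by (metis span_eq_iff)
    qed
    then have "range (\<lambda>h :: real \<times> ('p, 'q, 'n) jet. ?d (snd h)) = UNIV"
      unfolding surj_def by (metis snd_conv)
    ultimately show ?thesis by simp
  qed
  have "\<exists>q. smooth_on ?W q \<and> (\<forall>\<theta>\<in>?W. \<Delta> (prolonged_action \<theta>) $ \<nu> = q \<theta> \<bullet> \<Delta> (snd \<theta>))" for \<nu>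
  proof (rule division_by_submersion[OF open_regular_jets D])
    show "smooth_on ?W (\<lambda>\<theta>. \<Delta> (prolonged_action \<theta>) $ \<nu>)"
      by (intro smooth_on_vec_nth open_regular_jets F)
    show "\<Delta> (prolonged_action \<theta>) $ \<nu> = 0" if "\<theta> \<in> ?W" "\<Delta> (snd \<theta>) = 0" for \<theta>
      using prolonged_action_preserves_zero_set[OF solvable assms(4), of "fst \<theta>" "snd \<theta>"] that by simp
  qed (rule surj)
  then obtain q where q: "\<And>\<nu>. smooth_on ?W (q \<nu>)"
    and eq: "\<And>\<nu> \<theta>. \<theta> \<in> ?W \<Longrightarrow> \<Delta> (prolonged_action \<theta>) $ \<nu> = q \<nu> \<theta> \<bullet> \<Delta> (snd \<theta>)"
    by metis
  define V where "V \<eta> = {z. (\<eta>, z) \<in> ?W}" for \<eta>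
  define Q where "Q \<mu> \<nu> \<theta> = q \<nu> \<theta> $ \<mu>" for \<mu> \<nu> \<theta>
  have W: "Sigma ?I V = ?W" using W_jets(1) by (fastforce simp: V_def)
  show ?thesis
  proof (intro exI[of _ V] exI[of _ Q] conjI)
    show "\<forall>\<eta>\<in>?I. V \<eta> \<subseteq> jet_space M" using W_jets(2) by (fastforce simp: V_def)
    show "open (Sigma ?I V)" unfolding W by (rule open_regular_jets)
    show "\<forall>\<mu> \<nu>. smooth_on (Sigma ?I V) (Q \<mu> \<nu>)"
      unfolding W Q_def by (intro allI smooth_on_vec_nth open_regular_jets q)
    show "\<forall>\<eta> \<Omega> u \<Omega>' g\<eta>u.
         \<eta> \<in> ?I \<and> open \<Omega> \<and> smooth_on \<Omega> u \<and> is_transform U g \<eta> \<Omega> u \<Omega>' g\<eta>u \<longrightarrow>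
         (\<forall>x\<in>\<Omega>. (\<eta>, x, u x) \<in> U \<and> \<Xi> \<eta> (x, u x) \<in> \<Omega>' \<longrightarrow>
            (x, prolong u x) \<in> V \<eta> \<and>
            (\<forall>\<nu>. \<Delta> (\<Xi> \<eta> (x, u x), prolong g\<eta>u (\<Xi> \<eta> (x, u x))) $ \<nu> =
                 (\<Sum>\<mu>\<in>UNIV. Q \<mu> \<nu> (\<eta>, x, prolong u x) * \<Delta> (x, prolong u x) $ \<mu>)))"
    proof (intro allI impI ballI)
      fix \<eta> \<Omega> u \<Omega>' and g\<eta>u :: "real ^ 'p \<Rightarrow> real ^ 'q" and x
      assume A: "\<eta> \<in> ?I \<and> open \<Omega> \<and> smooth_on \<Omega> u \<and> is_transform U g \<eta> \<Omega> u \<Omega>' g\<eta>u"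
        and x: "x \<in> \<Omega>" "(\<eta>, x, u x) \<in> U \<and> \<Xi> \<eta> (x, u x) \<in> \<Omega>'"
      let ?\<theta> = "(\<eta>, x, prolong u x :: ('p, 'q, 'n) jet_fibre)"
      have \<Xi>: "fst (g \<eta> (x, u x)) = \<Xi> \<eta> (x, u x)" using assms(5) x(2) by simp
      have \<theta>: "?\<theta> \<in> ?W" "prolonged_action ?\<theta> = (\<Xi> \<eta> (x, u x), prolong g\<eta>u (\<Xi> \<eta> (x, u x)))"
        using prolonged_action_transform[of \<Omega> u \<eta> \<Omega>' g\<eta>u x, where 'n = 'n] A x unfolding \<Xi> by blast+
      then show "(x, prolong u x) \<in> V \<eta> \<and>
            (\<forall>\<nu>. \<Delta> (\<Xi> \<eta> (x, u x), prolong g\<eta>u (\<Xi> \<eta> (x, u x))) $ \<nu> =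
                 (\<Sum>\<mu>\<in>UNIV. Q \<mu> \<nu> ?\<theta> * \<Delta> (x, prolong u x) $ \<mu>))"
        using eq[OF \<theta>(1)] by (simp add: V_def Q_def inner_vec_def)
    qed
  qed
qed

end
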